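(* Let $n\geq 3$ and let $P\subset\mathbb{R}^n$ be an $n$-dimensional convex polytope with $0\in\operatorname{int}P$ such that, for every $k\in\{1,\ldots,n\}$, every nonempty proper face $F$ of $P$ of codimension $k$ satisfies $\operatorname{dist}(0,\operatorname{aff}F)\geq\sqrt{k}$. Then $$\Phi_{n-2}(P)\geq\frac{n-1}{2}\,(2\kappa_{n-1})^{1/(n-1)}\,(n2^n)^{(n-2)/(n-1)}.$$ Moreover, as $n\to\infty$, the right-hand side is asymptotically equivalent to $$\frac{\sqrt{2\pi e}}{4}\,2^n n^{3/2}$$ (that is, the ratio of the two expressions tends to $1$), where $\frac{\sqrt{2\pi e}}{4}\approx 1.0332$.
   Context: A polytope means a compact convex polyhedron. A face $F$ has codimension $k$ if $\dim F=n-k$; $\operatorname{aff}F$ is the affine hull of $F$. The total $(n-2)$-face measure is $\Phi_{n-2}(P)=\sum_{F}\mathcal{H}^{n-2}(F)$, the sum over all $(n-2)$-dimensional faces $F$ of $P$, where $\mathcal{H}^{n-2}$ is $(n-2)$-dimensional Hausdorff measure (Euclidean $(n-2)$-volume in the affine hull of $F$). $\kappa_m$ denotes the $m$-dimensional volume of the Euclidean unit ball in $\mathbb{R}^m$. *)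

theory Defs
  imports "HOL-Analysis.Analysis" "HOL-Library.Landau_Symbols"
begin

text \<open>
  Euclidean volume of the appropriate dimension on a nonempty affine subspace \<open>A\<close>, i.e. Lebesgue
  measure in Cartesian coordinates with respect to an orthonormal frame of \<open>A\<close>. The measure does
  not depend on the chosen frame. On Borel subsets of \<open>A\<close> it is the Hausdorff measure
  of dimension \<open>aff_dim A\<close> (normalised so that unit cubes have measure 1). The construction follows
  the library's definition of \<^const>\<open>lborel\<close>, which is the case of the frame \<open>(0, Basis)\<close>.
\<close>

definition orthonormal_frame :: "'a::euclidean_space set \<Rightarrow> 'a \<Rightarrow> 'a set \<Rightarrow> bool" where
  "orthonormal_frame A a B \<longleftrightarrow>
     pairwise orthogonal B \<and> (\<forall>b\<in>B. norm b = 1) \<and> A = (\<lambda>v. a + v) ` span B"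

definition frame_measure :: "'a::euclidean_space \<Rightarrow> 'a set \<Rightarrow> 'a measure" where
  "frame_measure a B =
     distr (\<Pi>\<^sub>M b\<in>B. (lborel :: real measure)) borel (\<lambda>f. a + (\<Sum>b\<in>B. f b *\<^sub>R b))"

definition flat_measure :: "'a::euclidean_space set \<Rightarrow> 'a measure" where
  "flat_measure A = (case (SOME (a, B). orthonormal_frame A a B) of (a, B) \<Rightarrow> frame_measure a B)"

lemma orthonormal_frame_exists:
  fixes A :: "'a::euclidean_space set"
  assumes "affine A" "A \<noteq> {}"
  shows "\<exists>a B. orthonormal_frame A a B"
proof -
  obtain a where a: "a \<in> A" using assms(2) by blast
  define S where "S = (\<lambda>x. -a + x) ` A"
  have S: "subspace S"
    unfolding S_def using affine_diffs_subspace[OF assms(1) a] by simp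
  obtain B where "pairwise orthogonal B" "\<And>b. b \<in> B \<Longrightarrow> norm b = 1" "span B = S"
    using orthonormal_basis_subspace[OF S] by metis
  moreover have "A = (\<lambda>v. a + v) ` S"
    by (auto simp: S_def image_image)
  ultimately show ?thesis
    unfolding orthonormal_frame_def by blast
qed

lemma sets_flat_measure [simp, measurable_cong]: "sets (flat_measure A) = sets borel"
  by (simp add: flat_measure_def frame_measure_def split: prod.split)

definition total_face_measure :: "nat \<Rightarrow> 'a::euclidean_space set \<Rightarrow> real" where
  "total_face_measure d P =
     (\<Sum>F | F face_of P \<and> aff_dim F = int d. measure (flat_measure (affine hull F)) F)"

definition ridge_bound :: "nat \<Rightarrow> real" where
  "ridge_bound n =
     (real n - 1) / 2 * (2 * unit_ball_vol (real n - 1)) powr (1 / (real n - 1))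
       * (real n * 2 ^ n) powr ((real n - 2) / (real n - 1))"

end

theory Submission
  imports Defs "HOL-Probability.Distributions" "HOL-Real_Asymp.Real_Asymp"
begin

text \<open>
  Let \<open>n = m + 2\<close>. The bound comes from evaluating the integral of the Gaussian \<open>exp (- |x|^2)\<close>
  over the whole space in two ways. Its value is \<open>pi^(n/2)\<close>. On the other hand the space is the
  union of the cones with apex \<open>0\<close> over the facets \<open>F\<close> of \<open>P\<close>, and each \<open>F\<close> is the union of the
  cones over its own facets \<open>G\<close>, which are ridges of \<open>P\<close>, with apex the point \<open>p\<close> of \<open>F\<close> nearest
  to \<open>0\<close>. So the integral is at most a sum over all flags \<open>(F, G)\<close> of weighted Gaussian integrals
  over the ridges, and the task is to bound the contribution of a flag by a constant times the
  volume of \<open>G\<close>.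

  Let \<open>d\<close> be the distance from \<open>p\<close> to the affine hull of \<open>G\<close>. Since \<open>p\<close> is a nearest point,
  \<open>p \<bullet> y \<ge> |p|^2\<close> for all \<open>y\<close> in \<open>F\<close>, and therefore
  \<open>|p + t (y - p)|^2 \<ge> (1 - t^2) |p|^2 + t^2 |y|^2\<close>. This decouples the apex from the base: after one
  integration is carried out (lemma \<open>nn_integral_fold_cones_le\<close>), all that is needed are upper bounds
  for the integral of \<open>exp (- b^2 |y|^2)\<close> over \<open>G\<close>. There are two such bounds.

  \<^item> By the hypothesis on the faces of all dimensions, the mean of a Gaussian over a face of
    codimension \<open>k\<close> is at most its mean over the face \<open>{1}^k \<times> [-1,1]^(n-k)\<close> of the cube
    (lemma \<open>face_integral_gaussian_le\<close>). This is an induction on the dimension that uses the same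
    decomposition into cones. The contribution of the flag is then at most \<open>d K vol G\<close>, where
    \<open>K = (sqrt pi / 2)^n / (n (n - 1))\<close>; for the cube, where \<open>d = 1\<close>, this is an equality.

  \<^item> All points of \<open>G\<close> satisfy \<open>|y|^2 \<ge> 1 + d^2\<close>. The contribution of the flag is then at most
    a constant times \<open>d^(2-n) vol G\<close>.

  The first bound grows with \<open>d\<close> and the second one decreases; they agree at a certain number
  \<open>d = \<rho>\<close> (\<open>ridge_scale\<close>), so that a flag never contributes more than \<open>\<rho> K vol G\<close>
  (lemmas \<open>ridge_profile_integral_le\<close> and \<open>facet_term_le\<close>). A ridge lies in at most two facets
  (lemma \<open>card_facets_through_ridge_le_2\<close>), hence \<open>pi^(n/2) \<le> 2 \<rho> K \<Phi>\<close>, where \<open>\<Phi>\<close> is the total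
  volume of the ridges. Solving for \<open>\<Phi>\<close> gives \<open>2^(n-1) n (n - 1) / \<rho>\<close>, and this number is exactly
  the bound of the theorem (lemma \<open>ridge_scale_bound\<close>).

  The same formula turns the asymptotic statement into one about \<open>\<rho>\<close>, that is, about the
  logarithm of the Gamma function at half-integers, for which comparison with
  \<open>x ln x - x\<close> is precise enough.
\<close>

section \<open>Lebesgue measure on flats\<close>

lemma measurable_frame_map [measurable]:
  fixes B :: "'a::euclidean_space set"
  assumes "finite B"
  shows "(\<lambda>f. a + (\<Sum>b\<in>B. f b *\<^sub>R b)) \<in> borel_measurable (\<Pi>\<^sub>M b\<in>B. (lborel :: real measure))"
  by measurable

lemma sets_frame_measure [simp, measurable_cong]: "sets (frame_measure a B) = sets borel"
  by (simp add: frame_measure_def)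

lemma space_frame_measure [simp]: "space (frame_measure a B) = UNIV"
  by (simp add: frame_measure_def)

lemma nn_integral_frame_measure:
  fixes B :: "'a::euclidean_space set"
  assumes [simp]: "finite B" and [measurable]: "F \<in> borel_measurable borel"
  shows "integral\<^sup>N (frame_measure a B) F
     = (\<integral>\<^sup>+f. F (a + (\<Sum>b\<in>B. f b *\<^sub>R b)) \<partial>(\<Pi>\<^sub>M b\<in>B. (lborel :: real measure)))"
  unfolding frame_measure_def by (subst nn_integral_distr) (auto intro!: measurable_frame_map)

lemma nn_integral_frame_measure_empty:
  fixes a :: "'a::euclidean_space"
  assumes [measurable]: "F \<in> borel_measurable borel"
  shows "integral\<^sup>N (frame_measure a {}) F = F a"
proof -
  interpret product_sigma_finite "\<lambda>b::'a. (lborel :: real measure)" ..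
  show ?thesis
    by (subst nn_integral_frame_measure) (auto simp: PiM_empty nn_integral_count_space_finite)
qed

lemma measurable_nn_integral_frame_measure:
  fixes B :: "'a::euclidean_space set"
  assumes [simp]: "finite B" and [measurable]: "F \<in> borel_measurable borel"
  shows "(\<lambda>u. integral\<^sup>N (frame_measure (a + u *\<^sub>R v) B) F) \<in> borel_measurable borel"
proof -
  interpret product_sigma_finite "\<lambda>b::'a. (lborel :: real measure)" ..
  interpret sigma_finite_measure "\<Pi>\<^sub>M b\<in>B. (lborel :: real measure)"
    by (rule sigma_finite) simp
  show ?thesis
    by (simp add: nn_integral_frame_measure cong: measurable_cong)
qed

text \<open>
  Fubini's theorem in frame coordinates. Together with the one-point case it allows properties of
  frame measures to be proved by induction on the frame.
\<close>
lemma nn_integral_frame_measure_insert: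
  fixes B :: "'a::euclidean_space set"
  assumes B [simp]: "finite B" "v \<notin> B" and [measurable]: "F \<in> borel_measurable borel"
  shows "integral\<^sup>N (frame_measure a (insert v B)) F
     = (\<integral>\<^sup>+u. integral\<^sup>N (frame_measure (a + u *\<^sub>R v) B) F \<partial>lborel)"
proof -
  interpret product_sigma_finite "\<lambda>b::'a. (lborel :: real measure)" ..
  have eq: "(\<Sum>b\<in>B. (if b = v then u else f b) *\<^sub>R b) = (\<Sum>b\<in>B. f b *\<^sub>R b)" for u f
    using B by (intro sum.cong) auto
  show ?thesis
    by (simp add: nn_integral_frame_measure)
       (subst product_nn_integral_insert_rev, simp_all add: eq algebra_simps)
qed

text \<open>
  Homotheties and point reflections (\<open>s = - 1\<close>) act on a frame measure by the power of the
  scaling factor given by the number of frame vectors. Translations are the case \<open>s = 1\<close>.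
\<close>
lemma nn_integral_frame_measure_affine:
  fixes B :: "'a::euclidean_space set"
  assumes "finite B" "s \<noteq> 0" and [measurable]: "F \<in> borel_measurable borel"
  shows "integral\<^sup>N (frame_measure (c + s *\<^sub>R w) B) F
     = ennreal (\<bar>s\<bar> ^ card B) * (\<integral>\<^sup>+x. F (c + s *\<^sub>R x) \<partial>frame_measure w B)"
  using assms(1)
proof (induction B arbitrary: w)
  case empty
  then show ?case by (simp add: nn_integral_frame_measure_empty)
next
  case (insert v B)
  note [measurable] = measurable_nn_integral_frame_measure
  let ?h = "\<lambda>u. integral\<^sup>N (frame_measure (c + s *\<^sub>R w + u *\<^sub>R v) B) F"
  have "integral\<^sup>N (frame_measure (c + s *\<^sub>R w) (insert v B)) F = integral\<^sup>N lborel ?h"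
    using insert by (simp add: nn_integral_frame_measure_insert)
  also have "\<dots> = \<bar>s\<bar> * (\<integral>\<^sup>+u. ?h (0 + s * u) \<partial>lborel)"
    using insert assms by (intro nn_integral_real_affine) auto
  also have "\<dots> = \<bar>s\<bar> * (\<integral>\<^sup>+u. ennreal (\<bar>s\<bar> ^ card B) * (\<integral>\<^sup>+x. F (c + s *\<^sub>R x) \<partial>frame_measure (w + u *\<^sub>R v) B) \<partial>lborel)"
    using insert.IH[of "w + _ *\<^sub>R v"] by (simp add: algebra_simps)
  also have "\<dots> = ennreal \<bar>s\<bar> * (ennreal (\<bar>s\<bar> ^ card B) * (\<integral>\<^sup>+u. (\<integral>\<^sup>+x. F (c + s *\<^sub>R x) \<partial>frame_measure (w + u *\<^sub>R v) B) \<partial>lborel))"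
    using insert by (subst nn_integral_cmult) auto
  also have "\<dots> = ennreal (\<bar>s\<bar> ^ card (insert v B)) * (\<integral>\<^sup>+x. F (c + s *\<^sub>R x) \<partial>frame_measure w (insert v B))"
    using insert by (simp add: nn_integral_frame_measure_insert ennreal_mult mult.assoc)
  finally show ?case .
qed

lemma nn_integral_frame_measure_translate:
  fixes B :: "'a::euclidean_space set"
  assumes "finite B" "y \<in> span B" and [measurable]: "F \<in> borel_measurable borel"
  shows "integral\<^sup>N (frame_measure (a + y) B) F = integral\<^sup>N (frame_measure a B) F"
  using assms(1,2)
proof (induction B arbitrary: a y)
  case empty
  then show ?case by simp
next
  case (insert v B)
  note [measurable] = measurable_nn_integral_frame_measure
  obtain t where t: "y - t *\<^sub>R v \<in> span B"
    using insert.prems span_breakdown_eq by blast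
  let ?h = "\<lambda>u. integral\<^sup>N (frame_measure (a + u *\<^sub>R v) B) F"
  have "integral\<^sup>N (frame_measure (a + y) (insert v B)) F
      = (\<integral>\<^sup>+u. integral\<^sup>N (frame_measure ((a + (t + u) *\<^sub>R v) + (y - t *\<^sub>R v)) B) F \<partial>lborel)"
    using insert by (simp add: nn_integral_frame_measure_insert algebra_simps)
  also have "\<dots> = (\<integral>\<^sup>+u. ?h (t + 1 * u) \<partial>lborel)"
    using insert.IH[OF t] by simp
  also have "\<dots> = integral\<^sup>N lborel ?h"
    using insert nn_integral_real_affine[of ?h 1 t] by simp
  finally show ?case
    using insert by (simp add: nn_integral_frame_measure_insert)
qed

lemma nn_integral_gaussian_line: "(\<integral>\<^sup>+x. ennreal (exp (- x\<^sup>2)) \<partial>lborel) = ennreal (sqrt pi)"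
proof -
  have "has_bochner_integral lborel (\<lambda>x::real. exp (- x\<^sup>2)) (2 *\<^sub>R (sqrt pi / 2))"
    by (rule has_bochner_integral_even_function[OF gaussian_moment_0]) simp
  then show ?thesis
    by (auto simp: has_bochner_integral_iff nn_integral_eq_integral)
qed

lemma orthonormal_finite:
  fixes B :: "'a::euclidean_space set"
  assumes "pairwise orthogonal B" "\<forall>b\<in>B. norm b = 1"
  shows "finite B" "independent B"
proof -
  show "finite B" using assms(1) by (rule pairwise_orthogonal_imp_finite)
  have "0 \<notin> B" using assms(2) by force
  then show "independent B" using assms(1) pairwise_orthogonal_independent by blast
qed

lemma norm_sum_orthonormal:
  fixes B :: "'a::euclidean_space set"
  assumes "pairwise orthogonal B" "\<forall>b\<in>B. norm b = 1"
  shows "(norm (\<Sum>b\<in>B. f b *\<^sub>R b))\<^sup>2 = (\<Sum>b\<in>B. (f b)\<^sup>2)"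
proof -
  have "(norm (\<Sum>b\<in>B. f b *\<^sub>R b))\<^sup>2 = (\<Sum>b\<in>B. (norm (f b *\<^sub>R b))\<^sup>2)"
    using assms orthonormal_finite[OF assms]
    by (intro norm_sum_Pythagorean) (auto simp: pairwise_def orthogonal_clauses)
  then show ?thesis using assms by simp
qed

lemma nn_integral_gaussian_frame:
  fixes B :: "'a::euclidean_space set"
  assumes "pairwise orthogonal B" "\<forall>b\<in>B. norm b = 1"
  shows "(\<integral>\<^sup>+x. ennreal (exp (- (norm x)\<^sup>2)) \<partial>frame_measure 0 B) = ennreal (sqrt pi ^ card B)"
proof -
  interpret product_sigma_finite "\<lambda>b::'a. (lborel :: real measure)" ..
  note [simp] = orthonormal_finite[OF assms]
  have "(\<integral>\<^sup>+x. ennreal (exp (- (norm x)\<^sup>2)) \<partial>frame_measure 0 B)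
    = (\<integral>\<^sup>+f. (\<Prod>b\<in>B. ennreal (exp (- (f b)\<^sup>2))) \<partial>(\<Pi>\<^sub>M b\<in>B. (lborel :: real measure)))"
    by (simp add: nn_integral_frame_measure norm_sum_orthonormal[OF assms] prod_ennreal
        flip: exp_sum sum_negf)
  also have "\<dots> = (\<Prod>b\<in>B. (\<integral>\<^sup>+x. ennreal (exp (- x\<^sup>2)) \<partial>lborel))"
    by (rule product_nn_integral_prod) auto
  finally show ?thesis
    by (simp add: nn_integral_gaussian_line ennreal_power)
qed

text \<open>
  This is the usual uniqueness argument for Haar measure, run with the test function
  \<open>H x = exp (- |x|^2)\<close>. Its integral has the same finite positive value \<open>c\<close> for all orthonormal frames
  of a given size. In the double integral of \<open>F x * H (y - x)\<close>, with \<open>x\<close> measured by the first frame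
  and \<open>y\<close> by the second, integrating over \<open>y\<close> first gives \<open>c\<close> times the integral of \<open>F\<close> for the first
  frame, and substituting \<open>y - x\<close> for \<open>x\<close> gives \<open>c\<close> times the integral of \<open>F\<close> for the second frame.
\<close>
lemma nn_integral_frame_measure_independent:
  fixes B B' :: "'a::euclidean_space set"
  assumes B: "pairwise orthogonal B" "\<forall>b\<in>B. norm b = 1"
    and B': "pairwise orthogonal B'" "\<forall>b\<in>B'. norm b = 1"
    and span: "span B = span B'"
    and F [measurable]: "F \<in> borel_measurable borel"
  shows "integral\<^sup>N (frame_measure 0 B) F = integral\<^sup>N (frame_measure 0 B') F"
proof -
  interpret product_sigma_finite "\<lambda>b::'a. (lborel :: real measure)" ..
  note fin = orthonormal_finite[OF B] orthonormal_finite[OF B']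
  note [simp] = fin
  have card: "card B = card B'"
    using dim_eq_card[of B "span B"] dim_eq_card[of B' "span B"] span fin by (metis dim_span dim_eq_card_independent)
  let ?P = "\<Pi>\<^sub>M b\<in>B. (lborel :: real measure)" and ?P' = "\<Pi>\<^sub>M b\<in>B'. (lborel :: real measure)"
  interpret P: sigma_finite_measure ?P by (rule sigma_finite) simp
  interpret P': sigma_finite_measure ?P' by (rule sigma_finite) simp
  interpret PP': pair_sigma_finite ?P ?P' ..
  define \<sigma> where "\<sigma> f = (\<Sum>b\<in>B. f b *\<^sub>R b)" for f :: "'a \<Rightarrow> real"
  define \<sigma>' where "\<sigma>' f = (\<Sum>b\<in>B'. f b *\<^sub>R b)" for f :: "'a \<Rightarrow> real"
  have [measurable]: "\<sigma> \<in> borel_measurable ?P" "\<sigma>' \<in> borel_measurable ?P'"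
    unfolding \<sigma>_def \<sigma>'_def by measurable
  have in_span: "\<sigma> f \<in> span B'" "\<sigma> f \<in> span B" "\<sigma>' f \<in> span B" "\<sigma>' f \<in> span B'" for f
    by (auto simp: \<sigma>_def \<sigma>'_def span span_base intro!: span_sum span_scale)
       (auto simp: span_base span[symmetric] intro!: span_sum span_scale)
  have int: "integral\<^sup>N (frame_measure 0 B) G = (\<integral>\<^sup>+f. G (\<sigma> f) \<partial>?P)" 
      if "G \<in> borel_measurable borel" for G
    using that by (simp add: nn_integral_frame_measure \<sigma>_def)
  have int': "integral\<^sup>N (frame_measure 0 B') G = (\<integral>\<^sup>+f. G (\<sigma>' f) \<partial>?P')" 
      if "G \<in> borel_measurable borel" for G
    using that by (simp add: nn_integral_frame_measure \<sigma>'_def)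
  have transl': "(\<integral>\<^sup>+g. G (\<sigma>' g - y) \<partial>?P') = integral\<^sup>N (frame_measure 0 B') G" 
    if [measurable]: "G \<in> borel_measurable borel" and "y \<in> span B'" for G y
  proof -
    have "integral\<^sup>N (frame_measure (0 + - y) B') G = integral\<^sup>N (frame_measure 0 B') G"
      using that by (intro nn_integral_frame_measure_translate) (auto intro: span_neg)
    then show ?thesis by (simp add: nn_integral_frame_measure \<sigma>'_def)
  qed
  have refl: "(\<integral>\<^sup>+f. G (y - \<sigma> f) \<partial>?P) = integral\<^sup>N (frame_measure 0 B) G"
    if [measurable]: "G \<in> borel_measurable borel" and "y \<in> span B" for G y
  proof -
    have "integral\<^sup>N (frame_measure (0 + y) B) G = integral\<^sup>N (frame_measure 0 B) G"
      using that by (intro nn_integral_frame_measure_translate) auto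
    moreover have "integral\<^sup>N (frame_measure (y + (-1) *\<^sub>R 0) B) G = (\<integral>\<^sup>+x. G (y + (-1) *\<^sub>R x) \<partial>frame_measure 0 B)"
      using that by (subst nn_integral_frame_measure_affine) auto
    ultimately show ?thesis by (simp add: int)
  qed
  define H where "H x = ennreal (exp (- (norm x)\<^sup>2))" for x :: 'a
  have H [measurable]: "H \<in> borel_measurable borel" unfolding H_def by measurable
  let ?c = "ennreal (sqrt pi ^ card B)"
  have HB: "integral\<^sup>N (frame_measure 0 B) H = ?c" "integral\<^sup>N (frame_measure 0 B') H = ?c"
    unfolding H_def using nn_integral_gaussian_frame[OF B] nn_integral_gaussian_frame[OF B'] card by auto
  have "integral\<^sup>N (frame_measure 0 B) F * ?c = (\<integral>\<^sup>+f. F (\<sigma> f) * ?c \<partial>?P)"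
    by (simp add: int nn_integral_multc)
  also have "\<dots> = (\<integral>\<^sup>+f. (\<integral>\<^sup>+g. F (\<sigma> f) * H (\<sigma>' g - \<sigma> f) \<partial>?P') \<partial>?P)"
    by (intro nn_integral_cong) (simp add: nn_integral_cmult transl'[OF H in_span(1)] HB(2))
  also have "\<dots> = (\<integral>\<^sup>+g. (\<integral>\<^sup>+f. F (\<sigma> f) * H (\<sigma>' g - \<sigma> f) \<partial>?P) \<partial>?P')"
    by (rule PP'.Fubini'[symmetric]) measurable
  also have "\<dots> = (\<integral>\<^sup>+g. (\<integral>\<^sup>+f. F (\<sigma>' g - \<sigma> f) * H (\<sigma> f) \<partial>?P) \<partial>?P')"
  proof (rule nn_integral_cong)
    fix g
    let ?G = "\<lambda>x. F x * H (\<sigma>' g - x)"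
    have "(\<integral>\<^sup>+f. ?G (\<sigma>' g - \<sigma> f) \<partial>?P) = (\<integral>\<^sup>+f. ?G (\<sigma> f) \<partial>?P)"
      using in_span by (subst refl) (auto simp: int)
    then show "(\<integral>\<^sup>+f. F (\<sigma> f) * H (\<sigma>' g - \<sigma> f) \<partial>?P) = (\<integral>\<^sup>+f. F (\<sigma>' g - \<sigma> f) * H (\<sigma> f) \<partial>?P)"
      by simp
  qed
  also have "\<dots> = (\<integral>\<^sup>+f. (\<integral>\<^sup>+g. F (\<sigma>' g - \<sigma> f) * H (\<sigma> f) \<partial>?P') \<partial>?P)"
    by (rule PP'.Fubini') measurable
  also have "\<dots> = (\<integral>\<^sup>+f. integral\<^sup>N (frame_measure 0 B') F * H (\<sigma> f) \<partial>?P)"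
    by (intro nn_integral_cong) (simp add: nn_integral_multc transl'[OF F in_span(1)])
  also have "\<dots> = integral\<^sup>N (frame_measure 0 B') F * ?c"
    using HB(1) by (simp add: nn_integral_cmult int)
  finally show ?thesis
    by (simp add: ennreal_mult_cancel_left mult.commute[of _ ?c])
qed

lemma frame_measure_unique:
  fixes A :: "'a::euclidean_space set"
  assumes "orthonormal_frame A a B" "orthonormal_frame A a' B'"
  shows "frame_measure a B = frame_measure a' B'"
proof -
  have B: "pairwise orthogonal B" "\<forall>b\<in>B. norm b = 1" and B': "pairwise orthogonal B'" "\<forall>b\<in>B'. norm b = 1"
    and A: "A = (+) a ` span B" "A = (+) a' ` span B'"
    using assms by (auto simp: orthonormal_frame_def)
  have fin [simp]: "finite B" "finite B'"
    using orthonormal_finite[OF B] orthonormal_finite[OF B'] by auto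
  have "a \<in> A" "a' \<in> A" using A span_zero by (metis add.right_neutral image_eqI)+
  then obtain y y' where "y \<in> span B'" "a = a' + y" "y' \<in> span B" "a' = a + y'"
    using A by blast
  then have d: "a - a' \<in> span B'" "a' - a \<in> span B" by (metis add_diff_cancel_left')+
  have span: "span B = span B'"
  proof (intro set_eqI iffI)
    fix x assume "x \<in> span B"
    then have "a + x \<in> A" using A(1) by blast
    then obtain y where "y \<in> span B'" "a + x = a' + y" using A(2) by blast
    then have "x = y - (a - a')" by (simp add: algebra_simps)
    then show "x \<in> span B'" using d \<open>y \<in> span B'\<close> by (simp add: span_diff)
  next
    fix x assume "x \<in> span B'"
    then have "a' + x \<in> A" using A(2) by blast
    then obtain y where "y \<in> span B" "a' + x = a + y" using A(1) by blast
    then have "x = y - (a' - a)" by (simp add: algebra_simps)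
    then show "x \<in> span B" using d \<open>y \<in> span B\<close> by (simp add: span_diff)
  qed
  show ?thesis
  proof (rule measure_eqI)
    show "sets (frame_measure a B) = sets (frame_measure a' B')" by simp
    fix S assume "S \<in> sets (frame_measure a B)"
    then have [measurable]: "S \<in> sets borel" by simp
    have shift: "integral\<^sup>N (frame_measure c D) F = (\<integral>\<^sup>+x. F (c + x) \<partial>frame_measure 0 D)"
      if "finite D" "F \<in> borel_measurable borel" for c D and F :: "'a \<Rightarrow> ennreal"
      using nn_integral_frame_measure_affine[of D 1 F c 0] that by simp
    have "emeasure (frame_measure a B) S = integral\<^sup>N (frame_measure (a' + (a - a')) B) (indicator S)"
      by simp
    also have "\<dots> = integral\<^sup>N (frame_measure a' B) (indicator S)"
      using d span by (intro nn_integral_frame_measure_translate) auto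
    also have "\<dots> = integral\<^sup>N (frame_measure a' B') (indicator S)"
      by (simp only: shift fin borel_measurable_indicator \<open>S \<in> sets borel\<close>)
         (rule nn_integral_frame_measure_independent[OF B B' span], measurable)
    finally show "emeasure (frame_measure a B) S = emeasure (frame_measure a' B') S" by simp
  qed
qed

text \<open>
  The choice made in the definition of the flat measure is immaterial, so a frame adapted to the
  geometric situation at hand can be used.
\<close>
lemma flat_measure_eq_frame_measure:
  assumes "orthonormal_frame A a B"
  shows "flat_measure A = frame_measure a B"
proof -
  define p where "p = (SOME (a, B). orthonormal_frame A a B)"
  have "case p of (a, B) \<Rightarrow> orthonormal_frame A a B"
    unfolding p_def using assms by (intro someI[of "\<lambda>(a, B). orthonormal_frame A a B" "(a, B)"]) auto
  then show ?thesis
    using assms frame_measure_unique by (auto simp: flat_measure_def p_def[symmetric] split: prod.splits)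
qed

lemma flat_measure_UNIV: "flat_measure (UNIV :: 'a::euclidean_space set) = lborel"
proof -
  have "orthonormal_frame (UNIV :: 'a set) 0 Basis"
    by (auto simp: orthonormal_frame_def pairwise_def orthogonal_def inner_Basis)
  from flat_measure_eq_frame_measure[OF this] show ?thesis
    by (simp only: frame_measure_def add_0 lborel_eq[symmetric])
qed

section \<open>Polar coordinates on a flat\<close>

lemma aff_dim_orthonormal_frame:
  fixes A :: "'a::euclidean_space set"
  assumes "orthonormal_frame A a B"
  shows "aff_dim A = int (card B)" "affine A" "a \<in> A" "finite B"
proof -
  have B: "pairwise orthogonal B" "\<forall>b\<in>B. norm b = 1" and A: "A = (+) a ` span B"
    using assms by (auto simp: orthonormal_frame_def)
  show "finite B" using orthonormal_finite[OF B] by simp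
  show "aff_dim A = int (card B)"
    using orthonormal_finite[OF B] unfolding A aff_dim_translation_eq
    by (simp add: aff_dim_subspace dim_eq_card_independent)
  show "affine A" unfolding A by (simp add: affine_translation[symmetric] subspace_imp_affine)
  show "a \<in> A" unfolding A using span_zero by force
qed

lemma orthonormal_frame_rebase:
  assumes "orthonormal_frame A a B" "a' \<in> A"
  shows "orthonormal_frame A a' B"
proof -
  have A: "A = (+) a ` span B" using assms by (auto simp: orthonormal_frame_def)
  then obtain y where y: "y \<in> span B" "a' = a + y" using assms by blast
  have "(+) a ` span B = (+) a' ` span B"
  proof (intro set_eqI iffI)
    fix x assume "x \<in> (+) a ` span B"
    then obtain z where z: "z \<in> span B" "x = a + z" by blast
    then have "x = a' + (z - y)" "z - y \<in> span B" using y by (auto simp: span_diff)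
    then show "x \<in> (+) a' ` span B" by blast
  next
    fix x assume "x \<in> (+) a' ` span B"
    then obtain z where z: "z \<in> span B" "x = a' + z" by blast
    then have "x = a + (y + z)" "y + z \<in> span B" using y by (auto simp: span_add)
    then show "x \<in> (+) a ` span B" by blast
  qed
  then show ?thesis using assms A by (auto simp: orthonormal_frame_def)
qed

text \<open>
  A frame of \<open>A\<close> with one vector normal to the smaller flat \<open>A'\<close> and the others spanning the
  rest of \<open>A\<close>. In codimension one these others form a frame of \<open>A'\<close>.
\<close>
lemma orthonormal_frame_normal:
  fixes A A' :: "'a::euclidean_space set"
  assumes "affine A" "affine A'" "A' \<subseteq> A" "A' \<noteq> {}" "aff_dim A' < aff_dim A"
  obtains a v B where "a \<in> A'" "norm v = 1" "\<And>b. b \<in> B \<Longrightarrow> b \<bullet> v = 0" "v \<notin> B"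
    "orthonormal_frame A a (insert v B)" "A' \<subseteq> (+) a ` span B"
proof -
  obtain a where a: "a \<in> A'" using assms by blast
  define U where "U = (+) (-a) ` A"
  define U' where "U' = (+) (-a) ` A'"
  have U: "subspace U" "subspace U'"
    using affine_diffs_subspace[OF assms(1), of a] affine_diffs_subspace[OF assms(2), of a] a assms(3)
    by (auto simp: U_def U'_def)
  have A: "A = (+) a ` U" "A' = (+) a ` U'" by (auto simp: U_def U'_def image_image)
  have sU: "span U = U" "span U' = U'" using U by simp_all
  have "U' \<noteq> U" using A assms(5) by auto
  then have "span U' \<subset> span U"
    using assms(3) unfolding sU by (auto simp: U_def U'_def)
  then obtain v0 where v0: "v0 \<noteq> 0" "v0 \<in> span U" "\<And>y. y \<in> span U' \<Longrightarrow> orthogonal v0 y"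
    using orthogonal_to_subspace_exists_gen by metis
  define v where "v = v0 /\<^sub>R norm v0"
  have v: "norm v = 1" "v \<in> U" "\<And>y. y \<in> U' \<Longrightarrow> v \<bullet> y = 0"
    using v0 U unfolding sU by (auto simp: v_def orthogonal_def intro: subspace_scale)
  have vv: "v \<bullet> v = 1" using v(1) by (simp add: norm_eq_1)
  define W where "W = U \<inter> {x. v \<bullet> x = 0}"
  have W: "subspace W" unfolding W_def using U(1) by (intro subspace_inter subspace_hyperplane)
  obtain B where B: "B \<subseteq> W" "pairwise orthogonal B" "\<And>x. x \<in> B \<Longrightarrow> norm x = 1" "span B = W"
    using orthonormal_basis_subspace[OF W] by metis
  have Bv: "b \<bullet> v = 0" if "b \<in> B" for b using that B(1) by (auto simp: W_def inner_commute)
  have "v \<notin> B" using Bv vv by force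
  have span: "span (insert v B) = U"
  proof
    show "span (insert v B) \<subseteq> U"
      using U v B by (intro span_minimal) (auto simp: W_def)
    show "U \<subseteq> span (insert v B)"
    proof
      fix x assume x: "x \<in> U"
      have "x - (v \<bullet> x) *\<^sub>R v \<in> W"
        using x U v vv by (auto simp: W_def inner_diff_right subspace_diff subspace_scale)
      then show "x \<in> span (insert v B)" using B(4) span_breakdown_eq by blast
    qed
  qed
  show ?thesis
  proof (rule that[OF a v(1) Bv \<open>v \<notin> B\<close>])
    show "orthonormal_frame A a (insert v B)"
      using B v(1) Bv span A by (auto simp: orthonormal_frame_def pairwise_insert orthogonal_def inner_commute)
    show "A' \<subseteq> (+) a ` span B"
      using A B(4) v(3) \<open>span U' \<subset> span U\<close> unfolding sU by (auto simp: W_def)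
  qed
qed

lemma inner_span_eq_0:
  assumes "x \<in> span B" "\<And>b. b \<in> B \<Longrightarrow> b \<bullet> v = 0"
  shows "x \<bullet> v = 0"
  using assms(1) by (induction rule: span_induct_alt) (use assms(2) in \<open>auto simp: inner_add_left\<close>)

lemma sum_in_span: "(\<Sum>b\<in>B. f b *\<^sub>R b) \<in> span B"
  by (intro span_sum span_scale span_base)

lemma borel_affine:
  fixes A :: "'a::euclidean_space set"
  shows "affine A \<Longrightarrow> A \<in> sets borel"
  by (metis affine_hull_eq borel_closed closed_affine_hull)

text \<open>
  In a frame of \<open>A\<close> with a vector \<open>v\<close> normal to \<open>A'\<close>, the coordinate along \<open>v\<close> is constant on \<open>A'\<close>,
  and a single value of this coordinate has measure zero.
\<close>
lemma null_sets_flat_measure: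
  fixes A A' :: "'a::euclidean_space set"
  assumes "affine A" "affine A'" "A' \<subseteq> A" "aff_dim A' < aff_dim A"
  shows "A' \<in> null_sets (flat_measure A)"
proof (cases "A' = {}")
  case False
  obtain a v B where *: "a \<in> A'" "norm v = 1" "\<And>b. b \<in> B \<Longrightarrow> b \<bullet> v = 0" "v \<notin> B"
    "orthonormal_frame A a (insert v B)" "A' \<subseteq> (+) a ` span B"
    using orthonormal_frame_normal[OF assms(1-3) False assms(4)] by metis
  have [measurable]: "A' \<in> sets borel" using assms borel_affine by auto
  have fin [simp]: "finite B" using aff_dim_orthonormal_frame[OF *(5)] by simp
  have "emeasure (flat_measure A) A' = integral\<^sup>N (frame_measure a (insert v B)) (indicator A')"
    using flat_measure_eq_frame_measure[OF *(5)] by simp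
  also have "\<dots> = (\<integral>\<^sup>+u. integral\<^sup>N (frame_measure (a + u *\<^sub>R v) B) (indicator A') \<partial>lborel)"
    using * by (intro nn_integral_frame_measure_insert) auto
  also have "\<dots> = (\<integral>\<^sup>+u. 0 \<partial>(lborel::real measure))"
  proof (intro nn_integral_cong_AE)
    have "integral\<^sup>N (frame_measure (a + u *\<^sub>R v) B) (indicator A') = 0" if "u \<noteq> 0" for u
    proof -
      have "a + u *\<^sub>R v + y \<notin> A'" if "y \<in> span B" for y
      proof
        assume "a + u *\<^sub>R v + y \<in> A'"
        then obtain z where "z \<in> span B" "u *\<^sub>R v + y = z" using *(6) by (force simp: add.assoc)
        then have "u *\<^sub>R v \<bullet> v = 0"
          using inner_span_eq_0[of y B v] inner_span_eq_0[of z B v] *(3) that by (auto simp: inner_add_left)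
        then show False using *(2) \<open>u \<noteq> 0\<close> by (simp add: norm_eq_1)
      qed
      then show ?thesis
        using sum_in_span[of _ B] by (subst nn_integral_frame_measure) auto
    qed
    then show "AE u in lborel. integral\<^sup>N (frame_measure (a + u *\<^sub>R v) B) (indicator A') = 0"
      using AE_lborel_singleton[of "0::real"] by auto
  qed
  finally show ?thesis by auto
qed auto

definition face_integral :: "'a::euclidean_space set \<Rightarrow> ('a \<Rightarrow> ennreal) \<Rightarrow> ennreal" where
  "face_integral G f = (\<integral>\<^sup>+y. indicator G y * f y \<partial>flat_measure (affine hull G))"

definition face_volume :: "'a::euclidean_space set \<Rightarrow> ennreal" where
  "face_volume G = emeasure (flat_measure (affine hull G)) G"

text \<open>
  The parameter set \<open>I\<close> is the interval \<open>(0, 1]\<close> for the pyramids inside a polytope and the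
  half-line \<open>(0, \<infinity>)\<close> for full cones.
\<close>
definition cone_part :: "'a::real_vector \<Rightarrow> real set \<Rightarrow> 'a set \<Rightarrow> 'a set" where
  "cone_part p I G = {p + s *\<^sub>R (y - p) | s y. s \<in> I \<and> y \<in> G}"

text \<open>
  Let \<open>A'\<close> be a hyperplane of the flat \<open>A\<close> not containing \<open>p\<close>. The points \<open>p + s (y - p)\<close> with
  \<open>y \<in> A'\<close> fill a parallel hyperplane at \<open>s\<close> times the distance from \<open>p\<close>, and on it the measure is
  the measure of \<open>A'\<close> scaled by \<open>s^m\<close>.
\<close>
lemma nn_integral_cone_part:
  fixes A A' :: "'a::euclidean_space set"
  assumes A: "affine A" "affine A'" "A' \<subseteq> A" "A' \<noteq> {}" "aff_dim A = int (Suc m)" "aff_dim A' = int m"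
    and p: "p \<in> A" "p \<notin> A'"
    and I [measurable]: "I \<in> sets borel" and I0: "I \<subseteq> {0<..}"
    and G [measurable]: "G \<in> sets borel" and GA: "G \<subseteq> A'"
    and f [measurable]: "f \<in> borel_measurable borel"
  shows "cone_part p I G \<in> sets borel" (is "?K \<in> _")
    and "(\<integral>\<^sup>+x. indicator (cone_part p I G) x * f x \<partial>flat_measure A)
       = ennreal (infdist p A') * (\<integral>\<^sup>+s. indicator I s * ennreal (s ^ m) *
           (\<integral>\<^sup>+y. indicator G y * f (p + s *\<^sub>R (y - p)) \<partial>flat_measure A') \<partial>lborel)"
proof -
  have "aff_dim A' < aff_dim A" using A(5,6) by simp
  then obtain a v B where *: "a \<in> A'" "norm v = 1" "\<And>b. b \<in> B \<Longrightarrow> b \<bullet> v = 0" "v \<notin> B"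
    "orthonormal_frame A a (insert v B)" "A' \<subseteq> (+) a ` span B"
    using orthonormal_frame_normal[OF A(1-4)] by metis
  have vv: "v \<bullet> v = 1" using *(2) by (simp add: norm_eq_1)
  have fin [simp]: "finite B" using aff_dim_orthonormal_frame[OF *(5)] by simp
  have cardB: "card B = m" using aff_dim_orthonormal_frame(1)[OF *(5)] A(5) *(4) by simp
  have B: "orthonormal_frame ((+) a ` span B) a B"
    using *(5) by (auto simp: orthonormal_frame_def pairwise_insert)
  have A'eq: "A' = (+) a ` span B"
    using aff_dim_orthonormal_frame[OF B] A cardB *(6) by (intro affine_dim_equal) auto
  have Aeq: "A = (+) a ` span (insert v B)" using *(5) by (auto simp: orthonormal_frame_def)
  \<comment> \<open>The signed distance from \<open>p\<close> to \<open>A'\<close>; the foot of the perpendicular is \<open>p + c v\<close>.\<close>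
  define c where "c = (a - p) \<bullet> v"
  obtain z t where z: "z \<in> span B" "p = a + (z + t *\<^sub>R v)"
  proof -
    obtain z' where "z' \<in> span (insert v B)" "p = a + z'" using p(1) Aeq by blast
    moreover from this obtain t where "z' - t *\<^sub>R v \<in> span B" using span_breakdown_eq by blast
    ultimately show ?thesis using that[of "z' - t *\<^sub>R v" t] by simp
  qed
  have "t = - c" using z vv inner_span_eq_0[OF z(1)] *(3)
    by (simp add: c_def inner_add_left inner_diff_left)
  then have foot: "p + c *\<^sub>R v \<in> A'" using z A'eq by force
  have dotv: "(y - p) \<bullet> v = c" if "y \<in> A'" for y
  proof -
    obtain z where "z \<in> span B" "y = a + z" using A'eq \<open>y \<in> A'\<close> by blast
    then show ?thesis using inner_span_eq_0[of z B v] *(3) by (auto simp: c_def inner_diff_left inner_add_left)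
  qed
  have c0: "c \<noteq> 0" using foot p by auto
  have dist: "infdist p A' = \<bar>c\<bar>"
  proof (rule antisym)
    show "infdist p A' \<le> \<bar>c\<bar>" using infdist_le[OF foot, of p] *(2) by (simp add: dist_norm)
    have "\<bar>c\<bar> \<le> dist p y" if "y \<in> A'" for y
      using dotv[OF that] Cauchy_Schwarz_ineq2[of "y - p" v] *(2) by (simp add: dist_norm norm_minus_commute)
    then show "\<bar>c\<bar> \<le> infdist p A'"
      using A(4) by (auto simp: infdist_notempty intro: cINF_greatest)
  qed
  have fA: "flat_measure A = frame_measure p (insert v B)"
    by (intro flat_measure_eq_frame_measure orthonormal_frame_rebase[OF *(5) p(1)])
  have fA': "flat_measure A' = frame_measure (p + c *\<^sub>R v) B"
    using A'eq B foot by (intro flat_measure_eq_frame_measure) (auto intro: orthonormal_frame_rebase)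
  have uniq: "s = s' \<and> y = y'" if "p + s *\<^sub>R (y - p) = p + s' *\<^sub>R (y' - p)" "y \<in> A'" "y' \<in> A'" "s' > 0" for s s' y y'
  proof -
    have eq: "s *\<^sub>R (y - p) = s' *\<^sub>R (y' - p)" using that by simp
    then have "s * c = s' * c" using that(2,3) dotv by (metis inner_scaleR_left)
    then show ?thesis using eq c0 that(4) by auto
  qed
  have Kiff: "p + s *\<^sub>R (y - p) \<in> ?K \<longleftrightarrow> s \<in> I \<and> y \<in> G" if "y \<in> A'" for s y
    using uniq that GA I0 unfolding cone_part_def by blast
  have "?K = {x. (x - p) \<bullet> v / c \<in> I \<and> p + (c / ((x - p) \<bullet> v)) *\<^sub>R (x - p) \<in> G}" (is "_ = ?K'")
  proof (intro set_eqI iffI)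
    fix x assume "x \<in> ?K"
    then obtain s y where x: "x = p + s *\<^sub>R (y - p)" "s \<in> I" "y \<in> G" by (auto simp: cone_part_def)
    moreover have "(x - p) \<bullet> v = s * c" using x dotv GA by auto
    moreover have "s > 0" using x I0 by auto
    ultimately show "x \<in> ?K'" using c0 by auto
  next
    fix x assume x: "x \<in> ?K'"
    define s where "s = (x - p) \<bullet> v / c"
    have s: "s \<in> I" "s > 0" using x I0 by (auto simp: s_def)
    have "c / ((x - p) \<bullet> v) = 1 / s" by (simp add: s_def)
    then have "x = p + s *\<^sub>R ((p + (c / ((x - p) \<bullet> v)) *\<^sub>R (x - p)) - p)" using s by simp
    then show "x \<in> ?K" using x s unfolding cone_part_def by blast
  qed
  moreover have "?K' \<in> sets borel" by measurable
  ultimately show [measurable]: "?K \<in> sets borel" by simp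
  have Sc: "integral\<^sup>N (frame_measure (p + s *\<^sub>R (c *\<^sub>R v)) B) F
      = ennreal (\<bar>s\<bar> ^ m) * (\<integral>\<^sup>+y. F (p + s *\<^sub>R (y - p)) \<partial>frame_measure (p + c *\<^sub>R v) B)"
    if "s \<noteq> 0" and [measurable]: "F \<in> borel_measurable borel" for s F
    using that nn_integral_frame_measure_affine[of B s F p "c *\<^sub>R v"]
      nn_integral_frame_measure_affine[of B 1 "\<lambda>y. F (p + s *\<^sub>R (y - p))" p "c *\<^sub>R v"]
    by (simp add: cardB)
  let ?F = "\<lambda>x. indicator ?K x * f x"
  have "integral\<^sup>N (flat_measure A) ?F = (\<integral>\<^sup>+u. integral\<^sup>N (frame_measure (p + u *\<^sub>R v) B) ?F \<partial>lborel)"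
    unfolding fA using *(4) by (intro nn_integral_frame_measure_insert) auto
  also have "\<dots> = \<bar>c\<bar> * (\<integral>\<^sup>+s. integral\<^sup>N (frame_measure (p + (0 + c * s) *\<^sub>R v) B) ?F \<partial>lborel)"
    using c0 by (intro nn_integral_real_affine measurable_nn_integral_frame_measure) auto
  also have "(\<integral>\<^sup>+s. integral\<^sup>N (frame_measure (p + (0 + c * s) *\<^sub>R v) B) ?F \<partial>lborel)
     = (\<integral>\<^sup>+s. indicator I s * ennreal (s ^ m) *
           (\<integral>\<^sup>+y. indicator G y * f (p + s *\<^sub>R (y - p)) \<partial>flat_measure A') \<partial>lborel)"
  proof (intro nn_integral_cong_AE)
    have "integral\<^sup>N (frame_measure (p + (0 + c * s) *\<^sub>R v) B) ?F = indicator I s * ennreal (s ^ m) *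
           (\<integral>\<^sup>+y. indicator G y * f (p + s *\<^sub>R (y - p)) \<partial>flat_measure A')" if "s \<noteq> 0" for s
    proof -
      have "integral\<^sup>N (frame_measure (p + (0 + c * s) *\<^sub>R v) B) ?F
         = ennreal (\<bar>s\<bar> ^ m) * (\<integral>\<^sup>+y. ?F (p + s *\<^sub>R (y - p)) \<partial>frame_measure (p + c *\<^sub>R v) B)"
        using Sc[OF that, of ?F] by (simp add: mult.commute)
      also have "(\<integral>\<^sup>+y. ?F (p + s *\<^sub>R (y - p)) \<partial>frame_measure (p + c *\<^sub>R v) B)
         = (\<integral>\<^sup>+y. indicator I s * (indicator G y * f (p + s *\<^sub>R (y - p))) \<partial>frame_measure (p + c *\<^sub>R v) B)"
      proof -
        have "p + c *\<^sub>R v + (\<Sum>b\<in>B. g b *\<^sub>R b) \<in> A'" for g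
          using orthonormal_frame_rebase[OF B, of "p + c *\<^sub>R v"] foot A'eq sum_in_span[of g B]
          by (auto simp: orthonormal_frame_def)
        note Kiff[OF this]
        then show ?thesis
          by (subst (1 2) nn_integral_frame_measure) (auto simp: indicator_def intro!: nn_integral_cong)
      qed
      finally show ?thesis
        using I0 by (auto simp: nn_integral_cmult fA' indicator_def ac_simps subset_iff)
    qed
    then show "AE s in lborel. integral\<^sup>N (frame_measure (p + (0 + c * s) *\<^sub>R v) B) ?F = indicator I s * ennreal (s ^ m) *
           (\<integral>\<^sup>+y. indicator G y * f (p + s *\<^sub>R (y - p)) \<partial>flat_measure A')"
      using AE_lborel_singleton[of "0::real"] by auto
  qed
  finally show "integral\<^sup>N (flat_measure A) ?F
       = ennreal (infdist p A') * (\<integral>\<^sup>+s. indicator I s * ennreal (s ^ m) *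
           (\<integral>\<^sup>+y. indicator G y * f (p + s *\<^sub>R (y - p)) \<partial>flat_measure A') \<partial>lborel)"
    by (simp add: dist)
qed

section \<open>Decomposition of a polytope into cones over its facets\<close>

text \<open>
  Facets whose affine hull contains \<open>p\<close> may be left out, because their cones lie in null sets. In
  the sum they have the coefficient zero.
\<close>
lemma nn_integral_le_cone_parts:
  fixes A S :: "'a::euclidean_space set" and \<G> :: "'a set set"
  assumes A: "affine A" "aff_dim A = int (Suc m)" and p: "p \<in> A"
    and fin [simp]: "finite \<G>"
    and G: "\<And>G. G \<in> \<G> \<Longrightarrow> G \<subseteq> A \<and> aff_dim G = int m \<and> G \<in> sets borel"
    and I [measurable]: "I \<in> sets borel" and I0: "I \<subseteq> {0<..}"
    and f [measurable]: "f \<in> borel_measurable borel"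
    and cover: "\<And>x. x \<in> S \<Longrightarrow> x \<noteq> p \<Longrightarrow> \<exists>G\<in>\<G>. x \<in> cone_part p I G"
  shows "(\<integral>\<^sup>+x. indicator S x * f x \<partial>flat_measure A)
    \<le> (\<Sum>G\<in>\<G>. ennreal (infdist p (affine hull G)) * (\<integral>\<^sup>+s. indicator I s * ennreal (s ^ m) *
           face_integral G (\<lambda>y. f (p + s *\<^sub>R (y - p))) \<partial>lborel))"
proof -
  \<comment> \<open>The cones over the members of \<open>\<N>\<close> are degenerate.\<close>
  let ?\<N> = "{G \<in> \<G>. p \<in> affine hull G}" and ?\<P> = "{G \<in> \<G>. p \<notin> affine hull G}"
  have aff: "affine hull G \<subseteq> A" "aff_dim (affine hull G) < aff_dim A" "affine hull G \<noteq> {}" 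
    "G \<noteq> {}" "G \<subseteq> affine hull G" if "G \<in> \<G>" for G
    using G[OF that] A(1,2) hull_subset[of G affine] by (auto simp: hull_minimal)
  have cone: "cone_part p I G \<in> sets borel"
    "(\<integral>\<^sup>+x. indicator (cone_part p I G) x * f x \<partial>flat_measure A)
       = ennreal (infdist p (affine hull G)) * (\<integral>\<^sup>+s. indicator I s * ennreal (s ^ m) *
           face_integral G (\<lambda>y. f (p + s *\<^sub>R (y - p))) \<partial>lborel)" if "G \<in> ?\<P>" for G
    using nn_integral_cone_part[of A "affine hull G" m p I G f] A p I I0 f that G[of G] aff[of G]
    by (auto simp: face_integral_def)
  have "(\<Union>G\<in>?\<N>. affine hull G) \<in> null_sets (flat_measure A)"
    using aff A by (intro null_sets.finite_UN) (auto intro!: null_sets_flat_measure)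
  moreover have "{p} \<in> null_sets (flat_measure A)"
    using A p by (intro null_sets_flat_measure) auto
  ultimately have N: "{p} \<union> (\<Union>G\<in>?\<N>. affine hull G) \<in> null_sets (flat_measure A)"
    by (intro null_sets.Un)
  have in_hull: "x \<in> affine hull G" if x: "x \<in> cone_part p I G" and "p \<in> affine hull G" for x G
  proof -
    obtain s y where sy: "x = p + s *\<^sub>R (y - p)" "y \<in> G" using x by (auto simp: cone_part_def)
    have "(1 - s) *\<^sub>R p + s *\<^sub>R y \<in> affine hull G"
      using \<open>p \<in> affine hull G\<close> sy(2) by (intro mem_affine[OF affine_affine_hull]) (auto simp: hull_inc)
    moreover have "(1 - s) *\<^sub>R p + s *\<^sub>R y = x" by (simp add: sy(1) algebra_simps)
    ultimately show ?thesis by simp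
  qed
  have "(\<integral>\<^sup>+x. indicator S x * f x \<partial>flat_measure A)
     \<le> (\<integral>\<^sup>+x. (\<Sum>G\<in>?\<P>. indicator (cone_part p I G) x * f x) \<partial>flat_measure A)"
  proof (intro nn_integral_mono_AE AE_I'[OF N] subsetI, rule ccontr)
    fix x assume x: "x \<in> {x \<in> space (flat_measure A). \<not> indicator S x * f x \<le> (\<Sum>G\<in>?\<P>. indicator (cone_part p I G) x * f x)}"
      and nx: "x \<notin> {p} \<union> (\<Union>G\<in>?\<N>. affine hull G)"
    have "x \<in> S" using x by (cases "x \<in> S") auto
    then obtain G where G': "G \<in> \<G>" "x \<in> cone_part p I G" using cover nx by auto
    then have "G \<in> ?\<P>" using in_hull nx by auto
    have "f x = (\<Sum>G\<in>{G}. indicator (cone_part p I G) x * f x)" using G' by simp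
    also have "\<dots> \<le> (\<Sum>G\<in>?\<P>. indicator (cone_part p I G) x * f x)"
      using \<open>G \<in> ?\<P>\<close> by (intro sum_mono2) auto
    finally show False using x \<open>x \<in> S\<close> by simp
  qed
  also have "\<dots> = (\<Sum>G\<in>?\<P>. (\<integral>\<^sup>+x. indicator (cone_part p I G) x * f x \<partial>flat_measure A))"
    using cone(1) by (intro nn_integral_sum) auto
  also have "\<dots> = (\<Sum>G\<in>?\<P>. ennreal (infdist p (affine hull G)) * (\<integral>\<^sup>+s. indicator I s * ennreal (s ^ m) *
           face_integral G (\<lambda>y. f (p + s *\<^sub>R (y - p))) \<partial>lborel))"
    using cone(2) by simp
  also have "\<dots> \<le> (\<Sum>G\<in>\<G>. ennreal (infdist p (affine hull G)) * (\<integral>\<^sup>+s. indicator I s * ennreal (s ^ m) *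
           face_integral G (\<lambda>y. f (p + s *\<^sub>R (y - p))) \<partial>lborel))"
    by (intro sum_mono2) auto
  finally show ?thesis .
qed

text \<open>
  Prolonging the segment from \<open>p\<close> to \<open>x\<close> as far as possible inside \<open>F\<close> ends at a point outside the
  relative interior, hence on a facet.
\<close>
lemma ray_meets_facet:
  fixes F :: "'a::euclidean_space set"
  assumes F: "polytope F" and p: "p \<in> F" and x: "x \<in> F" "x \<noteq> p"
  shows "\<exists>G. G facet_of F \<and> x \<in> cone_part p {0<..1} G"
proof -
  have cvx: "convex F" and cpt: "compact F" using F by (auto simp: polytope_imp_convex polytope_imp_compact)
  define T where "T = {1..} \<inter> (\<lambda>t::real. p + t *\<^sub>R (x - p)) -` F"
  have "closed T" unfolding T_def using cpt
    by (intro closed_Int closed_vimage) (auto intro!: continuous_intros compact_imp_closed)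
  moreover have "bounded T"
  proof -
    obtain r where r: "\<And>y. y \<in> F \<Longrightarrow> norm y \<le> r" using cpt compact_imp_bounded bounded_iff by metis
    have "norm t \<le> (r + norm p) / norm (x - p)" if "t \<in> T" for t
    proof -
      have "norm (p + t *\<^sub>R (x - p)) \<le> r" "t \<ge> 1" using that r by (auto simp: T_def)
      then have "t * norm (x - p) \<le> r + norm p"
        using norm_triangle_ineq4[of "p + t *\<^sub>R (x - p)" p] by simp
      then show ?thesis using x \<open>t \<ge> 1\<close> by (simp add: field_simps)
    qed
    then show ?thesis unfolding bounded_iff by blast
  qed
  moreover have "1 \<in> T" using x by (simp add: T_def)
  ultimately obtain t where t: "t \<in> T" "\<And>s. s \<in> T \<Longrightarrow> s \<le> t"
    using compact_attains_sup[of T] by (auto simp: compact_eq_bounded_closed)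
  define y where "y = p + t *\<^sub>R (x - p)"
  have t1: "t \<ge> 1" and y: "y \<in> F" using t(1) by (auto simp: T_def y_def)
  have "y \<notin> rel_interior F"
  proof
    assume "y \<in> rel_interior F"
    then obtain e where e: "e > 1" "(1 - e) *\<^sub>R p + e *\<^sub>R y \<in> F"
      using convex_rel_interior_iff[OF cvx] p by blast
    have "(1 - e) *\<^sub>R p + e *\<^sub>R y = p + (e * t) *\<^sub>R (x - p)" by (simp add: y_def algebra_simps)
    moreover have "e * t > t" using e t1 by auto
    moreover from this have "e * t \<ge> 1" using \<open>e * t > t\<close> t1 by linarith
    ultimately have "e * t \<in> T" using e by (auto simp: T_def)
    with t(2) \<open>e * t > t\<close> show False by force
  qed
  then have "y \<in> rel_frontier F"
    using y cpt by (simp add: rel_frontier_def compact_imp_closed)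
  then obtain G where G: "G facet_of F" "y \<in> G"
    using rel_frontier_of_polyhedron[OF polytope_imp_polyhedron[OF F]] by blast
  moreover have "x = p + (1 / t) *\<^sub>R (y - p)" using t1 by (simp add: y_def)
  moreover have "1 / t \<in> {0<..1}" using t1 by simp
  ultimately show ?thesis unfolding cone_part_def by blast
qed

lemma polytope_facet_borel:
  fixes F :: "'a::euclidean_space set"
  assumes "polytope F" "G facet_of F" "aff_dim F = int (Suc m)"
  shows "G \<subseteq> F" "aff_dim G = int m" "G \<in> sets borel" "polytope G" "G face_of F"
proof -
  show "G face_of F" using assms by (simp add: facet_of_def)
  then show P: "polytope G" using assms face_of_polytope_polytope by blast
  show "G \<subseteq> F" "aff_dim G = int m" using assms by (auto simp: facet_of_def dest: face_of_imp_subset)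
  show "G \<in> sets borel" using P by (simp add: borel_closed polytope_imp_closed)
qed

text \<open>
  The pyramids with apex \<open>p\<close> over the facets cover \<open>F\<close>, by \<open>ray_meets_facet\<close>.
\<close>
lemma face_integral_le_facets:
  fixes F :: "'a::euclidean_space set"
  assumes F: "polytope F" "aff_dim F = int (Suc m)" and p: "p \<in> F"
    and f [measurable]: "f \<in> borel_measurable borel"
  shows "face_integral F f
    \<le> (\<Sum>G | G facet_of F. ennreal (infdist p (affine hull G)) *
        (\<integral>\<^sup>+s. indicator {0<..1} s * ennreal (s ^ m) *
           face_integral G (\<lambda>y. f (p + s *\<^sub>R (y - p))) \<partial>lborel))"
  unfolding face_integral_def[of F]
proof (rule nn_integral_le_cone_parts)
  show "p \<in> affine hull F" using p by (simp add: hull_inc)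
  show "finite {G. G facet_of F}" using F by (simp add: finite_polytope_facets)
  show "G \<subseteq> affine hull F \<and> aff_dim G = int m \<and> G \<in> sets borel" if "G \<in> {G. G facet_of F}" for G
    using polytope_facet_borel[OF F(1) _ F(2), of G] that hull_subset[of F affine] by auto
  show "\<exists>G\<in>{G. G facet_of F}. x \<in> cone_part p {0<..1} G" if "x \<in> F" "x \<noteq> p" for x
    using ray_meets_facet[OF F(1) p that] by auto
qed (use F in auto)

lemma nn_integral_lborel_le_facets:
  fixes P :: "'a::euclidean_space set"
  assumes P: "polytope P" "0 \<in> interior P" "DIM('a) = Suc m"
    and f [measurable]: "f \<in> borel_measurable borel"
  shows "integral\<^sup>N lborel f
    \<le> (\<Sum>G | G facet_of P. ennreal (infdist 0 (affine hull G)) *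
        (\<integral>\<^sup>+s. indicator {0<..} s * ennreal (s ^ m) *
           face_integral G (\<lambda>y. f (s *\<^sub>R y)) \<partial>lborel))"
proof -
  have "aff_dim P = int (Suc m)" using aff_dim_nonempty_interior[of P] P by auto
  have "(\<integral>\<^sup>+x. indicator UNIV x * f x \<partial>flat_measure UNIV)
    \<le> (\<Sum>G | G facet_of P. ennreal (infdist 0 (affine hull G)) *
        (\<integral>\<^sup>+s. indicator {0<..} s * ennreal (s ^ m) *
           face_integral G (\<lambda>y. f (0 + s *\<^sub>R (y - 0))) \<partial>lborel))"
  proof (rule nn_integral_le_cone_parts)
    show "finite {G. G facet_of P}" using P by (simp add: finite_polytope_facets)
    show "G \<subseteq> UNIV \<and> aff_dim G = int m \<and> G \<in> sets borel" if "G \<in> {G. G facet_of P}" for G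
      using polytope_facet_borel[OF P(1) _ \<open>aff_dim P = int (Suc m)\<close>, of G] that by auto
    show "\<exists>G\<in>{G. G facet_of P}. x \<in> cone_part 0 {0<..} G" if "x \<noteq> 0" for x
    proof -
      obtain e where e: "e > 0" "cball 0 e \<subseteq> P" using P(2) by (auto simp: mem_interior_cball)
      \<comment> \<open>Scaling \<open>x\<close> into \<open>P\<close> makes the bounded version of the statement applicable.\<close>
      define c where "c = e / norm x"
      have c: "c > 0" "c *\<^sub>R x \<in> P" using e that by (auto simp: c_def)
      have "0 \<in> P" using e by auto
      obtain G where G: "G facet_of P" "c *\<^sub>R x \<in> cone_part 0 {0<..1} G"
        using ray_meets_facet[OF P(1) \<open>0 \<in> P\<close> c(2)] c \<open>x \<noteq> 0\<close> by auto
      then obtain s y where sy: "c *\<^sub>R x = s *\<^sub>R y" "s > 0" "y \<in> G" by (auto simp: cone_part_def)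
      have "x = (1 / c) *\<^sub>R (c *\<^sub>R x)" using c by simp
      also have "\<dots> = (s / c) *\<^sub>R y" unfolding sy(1) by simp
      finally have "x = 0 + (s / c) *\<^sub>R (y - 0)" by simp
      moreover have "s / c \<in> {0<..}" using sy c by simp
      ultimately have "x \<in> cone_part 0 {0<..} G" using sy(3) unfolding cone_part_def by blast
      then show ?thesis using G by blast
    qed
  qed (use P in \<open>auto simp: aff_dim_UNIV\<close>)
  then show ?thesis by (simp add: flat_measure_UNIV)
qed

lemma face_integral_const:
  assumes "G \<in> sets borel"
  shows "face_integral G (\<lambda>y. c) = c * face_volume G"
  unfolding face_integral_def face_volume_def
  by (subst mult.commute, subst nn_integral_cmult_indicator) (use assms in auto)

lemma face_integral_mono:
  assumes "\<And>y. y \<in> G \<Longrightarrow> f y \<le> g y"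
  shows "face_integral G f \<le> face_integral G g"
  unfolding face_integral_def using assms by (intro nn_integral_mono) (auto simp: indicator_def)

lemma face_integral_cmult:
  assumes "G \<in> sets borel" "f \<in> borel_measurable borel"
  shows "face_integral G (\<lambda>y. c * f y) = c * face_integral G f"
  unfolding face_integral_def using assms
  by (subst nn_integral_cmult[symmetric]) (auto intro!: nn_integral_cong simp: mult.left_commute)

text \<open>
  For an apex outside the two facets, a ray from \<open>p\<close> leaves the half-space supporting \<open>F\<close> along
  either facet at the point where it hits that facet, so both points agree.
\<close>
lemma cone_part_facets_Int:
  fixes F :: "'a::euclidean_space set"
  assumes F: "polytope F" and p: "p \<in> F" 
    and G: "G facet_of F" "p \<notin> G" and G': "G' facet_of F" "p \<notin> G'"
  shows "cone_part p {0<..} G \<inter> cone_part p {0<..} G' \<subseteq> cone_part p {0<..} (G \<inter> G')"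
proof
  have le: "s \<le> s'" if H: "H facet_of F" "p \<notin> H" and eq: "s *\<^sub>R (y - p) = s' *\<^sub>R (y' - p)" 
    and "s > 0" "s' > 0" "y \<in> H" "y' \<in> F" for H s s' y y'
  proof -
    have "H exposed_face_of F"
      using H polytope_imp_polyhedron[OF F] by (simp add: exposed_face_of_polyhedron facet_of_def)
    then obtain a b where ab: "F \<subseteq> {x. a \<bullet> x \<le> b}" "H = F \<inter> {x. a \<bullet> x = b}"
      by (auto simp: exposed_face_of_def)
    have pos: "b - a \<bullet> p > 0" using ab p H(2) by force
    have "s * (b - a \<bullet> p) = s' * (a \<bullet> y' - a \<bullet> p)"
      using arg_cong[OF eq, of "inner a"] ab \<open>y \<in> H\<close> by (auto simp: inner_diff_right)
    also have "\<dots> \<le> s' * (b - a \<bullet> p)" using ab \<open>s' > 0\<close> \<open>y' \<in> F\<close> by (intro mult_left_mono) auto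
    finally show ?thesis using pos by simp
  qed
  fix x assume "x \<in> cone_part p {0<..} G \<inter> cone_part p {0<..} G'"
  then obtain s y s' y' where *: "x = p + s *\<^sub>R (y - p)" "s > 0" "y \<in> G" "x = p + s' *\<^sub>R (y' - p)" "s' > 0" "y' \<in> G'"
    unfolding cone_part_def by blast
  then have eq: "s *\<^sub>R (y - p) = s' *\<^sub>R (y' - p)" by simp
  have "y \<in> F" "y' \<in> F" using * G G' facet_of_imp_subset by blast+
  then have "s = s'"
    using le[OF G eq] le[OF G' eq[symmetric]] * by auto
  then have "y = y'" using eq * by simp
  then show "x \<in> cone_part p {0<..} (G \<inter> G')" using * by (auto simp: cone_part_def)
qed

text \<open>
  The pyramids with apex \<open>p\<close> over the facets lie in \<open>F\<close> and overlap only in null sets, namely in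
  cones over intersections of two facets.
\<close>
lemma face_volume_ge_facets:
  fixes F :: "'a::euclidean_space set"
  assumes F: "polytope F" "aff_dim F = int (Suc m)" and p: "p \<in> F"
  shows "(\<Sum>G | G facet_of F. ennreal (infdist p (affine hull G)) * face_volume G)
    \<le> ennreal (real (Suc m)) * face_volume F"
proof -
  define A where "A = affine hull F"
  define \<P> where "\<P> = {G. G facet_of F \<and> p \<notin> affine hull G}"
  let ?I = "{0<..1::real}"
  let ?K = "cone_part p ?I"
  have A: "affine A" "aff_dim A = int (Suc m)" "p \<in> A" using F p by (auto simp: A_def hull_inc)
  have fin [simp]: "finite {G. G facet_of F}" "finite \<P>"
    using F unfolding \<P>_def by (auto simp: finite_polytope_facets)
  note facet = polytope_facet_borel[OF F(1) _ F(2)]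
  have aff: "affine hull G \<subseteq> A" "affine hull G \<noteq> {}" "G \<subseteq> affine hull G" "p \<notin> G" if "G \<in> \<P>" for G
    using that facet[of G] hull_mono[of G F affine] hull_subset[of G affine] by (auto simp: \<P>_def A_def)
  have I: "(\<integral>\<^sup>+s. indicator ?I s * ennreal (s ^ m) \<partial>lborel) = ennreal (1 / real (Suc m))"
  proof -
    have "(\<integral>\<^sup>+s. indicator ?I s * ennreal (s ^ m) \<partial>lborel) = (\<integral>\<^sup>+s. ennreal (s ^ m) * indicator {0..1} s \<partial>lborel)"
      using AE_lborel_singleton[of "0::real"] by (intro nn_integral_cong_AE) (auto simp: indicator_def)
    also have "\<dots> = 1 ^ Suc m / real (Suc m) - 0 ^ Suc m / real (Suc m)"
      by (rule nn_integral_FTC_Icc) (auto intro!: derivative_eq_intros simp del: power_Suc of_nat_Suc)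
    finally show ?thesis by simp
  qed
  have cone: "cone_part p ?I H \<in> sets borel"
    "emeasure (flat_measure A) (cone_part p ?I H) = ennreal (infdist p (affine hull G)) * (ennreal (1 / real (Suc m)) * emeasure (flat_measure (affine hull G)) H)"
    if "G \<in> \<P>" "H \<subseteq> G" and [measurable]: "H \<in> sets borel" for G H
  proof -
    have "?I \<subseteq> {0<..}" "H \<subseteq> affine hull G" using that aff[of G] by auto
    then have *: "cone_part p ?I H \<in> sets borel"
      "(\<integral>\<^sup>+x. indicator (cone_part p ?I H) x * 1 \<partial>flat_measure A)
       = ennreal (infdist p (affine hull G)) * (\<integral>\<^sup>+s. indicator ?I s * ennreal (s ^ m) *
           (\<integral>\<^sup>+y. indicator H y * 1 \<partial>flat_measure (affine hull G)) \<partial>lborel)"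
      using nn_integral_cone_part[of A "affine hull G" m p ?I H "\<lambda>_. 1"] A that facet[of G] aff[of G]
      by (auto simp: \<P>_def)
    show "cone_part p ?I H \<in> sets borel" by fact
    then show "emeasure (flat_measure A) (cone_part p ?I H) = ennreal (infdist p (affine hull G)) * (ennreal (1 / real (Suc m)) * emeasure (flat_measure (affine hull G)) H)"
      using *(2) that by (simp add: nn_integral_multc I)
  qed
  have disj: "?K G \<inter> ?K G' \<in> null_sets (flat_measure A)" if GG: "G \<in> \<P>" "G' \<in> \<P>" "G \<noteq> G'" for G G'
  proof -
    have facets: "G facet_of F" "G' facet_of F" using GG by (auto simp: \<P>_def)
    have face: "G \<inter> G' face_of F" using facets by (intro face_of_Int) (auto simp: facet_of_def)
    then have faceG: "G \<inter> G' face_of G" using facet[of G] facets by (meson face_of_subset inf_le1)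
    have "G \<inter> G' \<noteq> G"
    proof
      assume eq: "G \<inter> G' = G"
      then have "G face_of G'" using face facet[of G'] facets by (metis face_of_subset inf_le2)
      then show False using face_of_aff_dim_lt[of G' G] GG facet[of G] facet[of G'] facets
        by (auto simp: polytope_imp_convex)
    qed
    then have "aff_dim (G \<inter> G') < aff_dim G"
      using facet[of G] facets faceG by (intro face_of_aff_dim_lt) (auto simp: polytope_imp_convex)
    then have "affine hull (G \<inter> G') \<in> null_sets (flat_measure (affine hull G))"
      using hull_mono[of "G \<inter> G'" G affine]
      by (intro null_sets_flat_measure) auto
    moreover have "G \<inter> G' \<in> sets borel" using facet[of G] facet[of G'] facets by auto
    ultimately have null: "G \<inter> G' \<in> null_sets (flat_measure (affine hull G))"
      by (metis hull_subset null_sets_subset sets_flat_measure)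
    have "?K (G \<inter> G') \<in> null_sets (flat_measure A)"
      using cone[of G "G \<inter> G'"] GG null by (auto simp: null_sets_def)
    moreover have "?K G \<inter> ?K G' \<in> sets borel"
      using cone(1)[of G G] cone(1)[of G' G'] GG facet[of G] facet[of G'] facets by auto
    moreover have "?K G \<inter> ?K G' \<subseteq> ?K (G \<inter> G')"
    proof
      fix x assume x: "x \<in> ?K G \<inter> ?K G'"
      then have "x \<in> cone_part p {0<..} G \<inter> cone_part p {0<..} G'" by (auto simp: cone_part_def)
      then have "x \<in> cone_part p {0<..} (G \<inter> G')"
        using cone_part_facets_Int[OF F(1) p, of G G'] aff GG facets by auto
      then obtain s y where 1: "x = p + s *\<^sub>R (y - p)" "y \<in> G \<inter> G'" "s > 0" by (auto simp: cone_part_def)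
      obtain s' y' where 2: "x = p + s' *\<^sub>R (y' - p)" "y' \<in> G" "s' \<in> ?I" using x by (auto simp: cone_part_def)
      have eq: "s *\<^sub>R (y - p) = s' *\<^sub>R (y' - p)" using 1 2 by simp
      have "s = s'"
      proof (rule ccontr)
        assume "s \<noteq> s'"
        then have "p = (s / (s - s')) *\<^sub>R y + (- s' / (s - s')) *\<^sub>R y'"
        proof -
          have "(s - s') *\<^sub>R p = s *\<^sub>R y - s' *\<^sub>R y'" using eq by (simp add: algebra_simps)
          then have "(1 / (s - s')) *\<^sub>R ((s - s') *\<^sub>R p) = (1 / (s - s')) *\<^sub>R (s *\<^sub>R y - s' *\<^sub>R y')" by simp
          then show ?thesis using \<open>s \<noteq> s'\<close> by (simp add: scaleR_diff_right)
        qed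
        moreover have "s / (s - s') + (- s' / (s - s')) = 1"
          using \<open>s \<noteq> s'\<close> by (simp flip: diff_divide_distrib)
        ultimately have "p \<in> affine hull G"
          using 1 2 by (metis IntD1 affine_affine_hull hull_inc mem_affine)
        then show False using GG by (auto simp: \<P>_def)
      qed
      then show "x \<in> ?K (G \<inter> G')" using 1 2 by (auto simp: cone_part_def)
    qed
    ultimately show ?thesis by (metis null_sets_subset sets_flat_measure)
  qed
  have KF: "?K G \<subseteq> F" if "G \<in> \<P>" for G
  proof
    fix x assume "x \<in> ?K G"
    then obtain s y where *: "x = p + s *\<^sub>R (y - p)" "s \<in> ?I" "y \<in> G" by (auto simp: cone_part_def)
    have "y \<in> F" using * that facet_of_imp_subset by (auto simp: \<P>_def)
    then have "(1 - s) *\<^sub>R p + s *\<^sub>R y \<in> F"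
      using polytope_imp_convex[OF F(1)] p * by (intro convexD_alt) auto
    moreover have "(1 - s) *\<^sub>R p + s *\<^sub>R y = x" using * by (simp add: algebra_simps)
    ultimately show "x \<in> F" by simp
  qed
  have "(\<Sum>G | G facet_of F. ennreal (infdist p (affine hull G)) * face_volume G)
      = (\<Sum>G\<in>\<P>. ennreal (infdist p (affine hull G)) * face_volume G)"
    by (intro sum.mono_neutral_right) (auto simp: \<P>_def)
  also have "\<dots> = ennreal (real (Suc m)) * (\<Sum>G\<in>\<P>. emeasure (flat_measure A) (?K G))"
  proof -
    have "ennreal (real (Suc m)) * emeasure (flat_measure A) (?K G) = ennreal (infdist p (affine hull G)) * face_volume G"
      if "G \<in> \<P>" for G
    proof -
      have "ennreal (real (Suc m)) * emeasure (flat_measure A) (?K G)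
        = (ennreal (real (Suc m)) * ennreal (1 / real (Suc m))) * (ennreal (infdist p (affine hull G)) * face_volume G)"
        using cone(2)[of G G] facet[of G] that by (simp add: face_volume_def \<P>_def ac_simps del: of_nat_Suc)
      also have "ennreal (real (Suc m)) * ennreal (1 / real (Suc m)) = 1"
        by (subst ennreal_mult'[symmetric]) (auto simp del: of_nat_Suc)
      finally show ?thesis by simp
    qed
    then show ?thesis by (simp add: sum_distrib_left)
  qed
  also have "(\<Sum>G\<in>\<P>. emeasure (flat_measure A) (?K G)) = (\<integral>\<^sup>+x. (\<Sum>G\<in>\<P>. indicator (?K G) x) \<partial>flat_measure A)"
    using cone(1) facet by (subst nn_integral_sum) (auto simp: \<P>_def)
  also have "\<dots> \<le> (\<integral>\<^sup>+x. indicator F x \<partial>flat_measure A)"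
  proof (intro nn_integral_mono_AE)
    have "AE x in flat_measure A. \<forall>G\<in>\<P>. \<forall>G'\<in>\<P>. G \<noteq> G' \<longrightarrow> x \<notin> ?K G \<inter> ?K G'"
      unfolding AE_finite_all[OF fin(2)]
    proof (intro ballI)
      fix G G' assume "G \<in> \<P>" "G' \<in> \<P>"
      then show "AE x in flat_measure A. G \<noteq> G' \<longrightarrow> x \<notin> ?K G \<inter> ?K G'"
        using AE_not_in[OF disj[of G G']] by (cases "G = G'") auto
    qed
    then show "AE x in flat_measure A. (\<Sum>G\<in>\<P>. indicator (?K G) x) \<le> (indicator F x :: ennreal)"
    proof eventually_elim
      case (elim x)
      show ?case
      proof (cases "\<exists>G\<in>\<P>. x \<in> ?K G")
        case True
        then obtain G where G: "G \<in> \<P>" "x \<in> ?K G" by blast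
        then have "(\<Sum>G\<in>\<P>. indicator (?K G) x :: ennreal) = (\<Sum>G\<in>{G}. indicator (?K G) x)"
          using elim by (intro sum.mono_neutral_right) (auto simp: indicator_def)
        moreover have "x \<in> F" using G KF by auto
        ultimately show ?thesis using G by simp
      qed auto
    qed
  qed
  also have "\<dots> = face_volume F"
    using F by (simp add: face_volume_def A_def borel_closed polytope_imp_closed)
  finally show ?thesis by (simp add: mult_left_mono)
qed

section \<open>One-dimensional Gaussian integrals\<close>

text \<open>
  The integral of \<open>exp (- x^2)\<close> from \<open>0\<close> to \<open>b\<close>. The lower limit \<open>- 1\<close> in the encoding makes
  the function differentiable in the ordinary two-sided sense on \<open>[0, \<infinity>)\<close>, including \<open>0\<close>.
\<close>
definition gauss_int :: "real \<Rightarrow> real" where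
  "gauss_int b = integral {-1..b} (\<lambda>x. exp (- x\<^sup>2)) - integral {-1..0} (\<lambda>x. exp (- x\<^sup>2))"

lemma gauss_int_0 [simp]: "gauss_int 0 = 0"
  by (simp add: gauss_int_def)

lemma DERIV_gauss_int [derivative_intros]:
  assumes "(f has_real_derivative f') (at x)" "f x \<ge> 0"
  shows "((\<lambda>x. gauss_int (f x)) has_real_derivative exp (- (f x)\<^sup>2) * f') (at x)"
proof -
  have "((\<lambda>b. integral {-1..b} (\<lambda>x. exp (- x\<^sup>2))) has_real_derivative exp (- (f x)\<^sup>2)) (at (f x) within {-1..f x + 1})"
    using assms(2) by (intro integral_has_real_derivative[where g="\<lambda>x. exp (- x\<^sup>2)"]) (auto intro!: continuous_intros)
  then have "((\<lambda>b. integral {-1..b} (\<lambda>x. exp (- x\<^sup>2))) has_real_derivative exp (- (f x)\<^sup>2)) (at (f x))"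
    using assms(2) by (subst (asm) at_within_interior) auto
  then have "(gauss_int has_real_derivative exp (- (f x)\<^sup>2) - 0) (at (f x))"
    unfolding gauss_int_def by (intro derivative_intros)
  then show ?thesis using DERIV_chain2[OF _ assms(1)] by simp
qed

lemma DERIV_gauss_int_at: "x \<ge> 0 \<Longrightarrow> (gauss_int has_real_derivative exp (- x\<^sup>2)) (at x)"
  using DERIV_gauss_int[of "\<lambda>x. x" 1 x] by simp

lemma gauss_int_mono: "0 \<le> a \<Longrightarrow> a \<le> b \<Longrightarrow> gauss_int a \<le> gauss_int b"
  by (rule DERIV_nonneg_imp_nondecreasing[of a b gauss_int])
     (auto intro!: exI conjI DERIV_gauss_int_at)

lemma gauss_int_nonneg: "0 \<le> b \<Longrightarrow> 0 \<le> gauss_int b"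
  using gauss_int_mono[of 0 b] by simp

lemma continuous_on_gauss_int: "continuous_on {0..} gauss_int"
  by (intro continuous_at_imp_continuous_on ballI DERIV_isCont[where D="exp (- _\<^sup>2)"])
     (auto intro: DERIV_gauss_int_at)

lemma tendsto_gauss_int: "(gauss_int \<longlongrightarrow> sqrt pi / 2) at_top"
proof -
  let ?f = "\<lambda>x::real. indicator {0..} x *\<^sub>R exp (- x\<^sup>2)"
  have f: "integrable lborel ?f" "integral\<^sup>L lborel ?f = sqrt pi / 2"
    using gaussian_moment_0 by (auto simp: has_bochner_integral_iff)
  have "((\<lambda>y. \<integral>x. indicator {..y} x *\<^sub>R ?f x \<partial>lborel) \<longlongrightarrow> sqrt pi / 2) at_top"
    unfolding f(2)[symmetric] by (rule tendsto_integral_at_top[OF _ f(1)]) simp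
  moreover have "eventually (\<lambda>y. (\<integral>x. indicator {..y} x *\<^sub>R ?f x \<partial>lborel) = gauss_int y) at_top"
    using eventually_ge_at_top[of 0]
  proof eventually_elim
    case (elim y)
    have "(\<integral>x. indicator {..y} x *\<^sub>R ?f x \<partial>lborel) = (\<integral>x. exp (- x\<^sup>2) * indicator {0..y} x \<partial>lborel)"
      by (intro Bochner_Integration.integral_cong) (auto simp: indicator_def)
    also have "\<dots> = gauss_int y - gauss_int 0"
      using elim by (intro integral_FTC_Icc_real) (auto intro: DERIV_gauss_int_at)
    finally show ?case by simp
  qed
  ultimately show ?thesis by (rule Lim_transform_eventually)
qed

lemma gauss_int_le: "0 \<le> b \<Longrightarrow> gauss_int b \<le> sqrt pi / 2"
  by (rule tendsto_lowerbound[OF tendsto_gauss_int])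
     (auto intro!: eventually_at_top_linorderI[of b] gauss_int_mono)

lemma nn_integral_gauss_tail:
  assumes "0 \<le> b"
  shows "(\<integral>\<^sup>+x. ennreal (exp (- x\<^sup>2)) * indicator {b..} x \<partial>lborel) = ennreal (sqrt pi / 2 - gauss_int b)"
  using assms by (intro nn_integral_FTC_atLeast tendsto_gauss_int)
    (auto intro: DERIV_gauss_int_at)

text \<open>
  The integrand is the derivative of \<open>gauss_int (b s)^(m+1) / ((m+1) b)\<close>. This identity closes the
  induction in the estimate of Gaussian means over faces.
\<close>
lemma nn_integral_gauss_int_power:
  assumes "b > 0"
  shows "(\<integral>\<^sup>+s. indicator {0<..1} s * ennreal (exp (- (b * s)\<^sup>2) * gauss_int (b * s) ^ m) \<partial>lborel)
    = ennreal (gauss_int b ^ Suc m / (real (Suc m) * b))"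
proof -
  have "(\<integral>\<^sup>+s. indicator {0<..1} s * ennreal (exp (- (b * s)\<^sup>2) * gauss_int (b * s) ^ m) \<partial>lborel)
     = (\<integral>\<^sup>+s. ennreal (exp (- (b * max 0 s)\<^sup>2) * gauss_int (b * max 0 s) ^ m) * indicator {0..1} s \<partial>lborel)"
    using AE_lborel_singleton[of "0::real"] by (intro nn_integral_cong_AE) (auto simp: indicator_def)
  also have "\<dots> = gauss_int (b * 1) ^ Suc m / (real (Suc m) * b) - gauss_int (b * 0) ^ Suc m / (real (Suc m) * b)"
  proof (rule nn_integral_FTC_Icc)
    have "continuous_on UNIV (\<lambda>s. exp (- (b * max 0 s)\<^sup>2) * gauss_int (b * max 0 s) ^ m)"
      using assms by (intro continuous_intros continuous_on_compose2[OF continuous_on_gauss_int]) auto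
    then show "(\<lambda>s. exp (- (b * max 0 s)\<^sup>2) * gauss_int (b * max 0 s) ^ m) \<in> borel_measurable borel"
      by (rule borel_measurable_continuous_onI)
    fix s :: real assume "s \<in> {0..1}"
    then have s: "0 \<le> s" "s \<le> 1" by auto
    then show "0 \<le> exp (- (b * max 0 s)\<^sup>2) * gauss_int (b * max 0 s) ^ m"
      using assms by (intro mult_nonneg_nonneg zero_le_power gauss_int_nonneg) auto
    have "((\<lambda>x. gauss_int (b * x) ^ Suc m / (real (Suc m) * b)) has_real_derivative
        (real (Suc m) * (gauss_int (b * s) ^ m) * (exp (- (b * s)\<^sup>2) * b)) / (real (Suc m) * b)) (at s)"
      using assms s by (auto intro!: derivative_eq_intros simp del: power_Suc of_nat_Suc)
    also have "(real (Suc m) * (gauss_int (b * s) ^ m) * (exp (- (b * s)\<^sup>2) * b)) / (real (Suc m) * b)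
      = exp (- (b * max 0 s)\<^sup>2) * gauss_int (b * max 0 s) ^ m"
    proof -
      have "(a * x * (y * b)) / (a * b) = y * x" if "a > 0" for a x y :: real
        using assms that by simp
      from this[of "real (Suc m)"] show ?thesis using s by (simp add: max_absorb2 del: of_nat_Suc)
    qed
    finally show "((\<lambda>x. gauss_int (b * x) ^ Suc m / (real (Suc m) * b)) has_real_derivative
        exp (- (b * max 0 s)\<^sup>2) * gauss_int (b * max 0 s) ^ m) (at s)" .
  qed simp
  finally show ?thesis by simp
qed

text \<open>
  With \<open>c = sqrt pi / 2\<close> and \<open>g = gauss_int b\<close>, the substitution by \<open>g\<close> turns the integral into that of
  \<open>(c - g) g^m\<close> over \<open>[0, c]\<close>.
\<close>
lemma nn_integral_cube_constant:
  "(\<integral>\<^sup>+b. ennreal ((sqrt pi / 2 - gauss_int b) * exp (- b\<^sup>2) * gauss_int b ^ m) * indicator {0<..} b \<partial>lborel)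
    = ennreal ((sqrt pi / 2) ^ (m + 2) / (real (m + 1) * real (m + 2)))"
proof -
  let ?c = "sqrt pi / 2"
  let ?f = "\<lambda>b. (?c - gauss_int (max 0 b)) * exp (- (max 0 b)\<^sup>2) * gauss_int (max 0 b) ^ m"
  let ?F = "\<lambda>b. ?c * gauss_int b ^ (m + 1) / real (m + 1) - gauss_int b ^ (m + 2) / real (m + 2)"
  have "(\<integral>\<^sup>+b. ennreal ((?c - gauss_int b) * exp (- b\<^sup>2) * gauss_int b ^ m) * indicator {0<..} b \<partial>lborel)
     = (\<integral>\<^sup>+b. ennreal (?f b) * indicator {0..} b \<partial>lborel)"
    using AE_lborel_singleton[of "0::real"] by (intro nn_integral_cong_AE) (auto simp: indicator_def)
  also have "\<dots> = (?c * ?c ^ (m + 1) / real (m + 1) - ?c ^ (m + 2) / real (m + 2)) - ?F 0"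
  proof (rule nn_integral_FTC_atLeast)
    have "continuous_on UNIV ?f"
      by (intro continuous_intros continuous_on_compose2[OF continuous_on_gauss_int]) auto
    then show "?f \<in> borel_measurable borel"
      by (rule borel_measurable_continuous_onI)
    fix s :: real assume s: "0 \<le> s"
    then show "0 \<le> ?f s"
      using gauss_int_le[OF s] gauss_int_nonneg[OF s] by (simp add: max_absorb2)
    have "(?F has_real_derivative
        ?c * (real (m + 1) * gauss_int s ^ m * exp (- s\<^sup>2)) / real (m + 1)
         - (real (m + 2) * gauss_int s ^ (m + 1) * exp (- s\<^sup>2)) / real (m + 2)) (at s)"
      using s by (auto intro!: derivative_eq_intros simp del: power_Suc of_nat_Suc of_nat_add)
    also have "?c * (real (m + 1) * gauss_int s ^ m * exp (- s\<^sup>2)) / real (m + 1)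
         - (real (m + 2) * gauss_int s ^ (m + 1) * exp (- s\<^sup>2)) / real (m + 2) = ?f s"
      using s by (simp add: max_absorb2 del: of_nat_Suc of_nat_add) (simp add: algebra_simps)
    finally show "(?F has_real_derivative ?f s) (at s)" .
  next
    show "(?F \<longlongrightarrow> ?c * ?c ^ (m + 1) / real (m + 1) - ?c ^ (m + 2) / real (m + 2)) at_top"
      by (intro tendsto_intros tendsto_gauss_int) auto
  qed
  also have "(?c * ?c ^ (m + 1) / real (m + 1) - ?c ^ (m + 2) / real (m + 2)) - ?F 0 = ?c ^ (m + 2) / (real (m + 1) * real (m + 2))"
  proof -
    have eq: "x / a - x / (a + 1) = x / (a * (a + 1))" if "a > 0" for x a :: real
      using that by (simp add: divide_simps) (simp add: algebra_simps)
    have "?c * ?c ^ (m + 1) = ?c ^ (m + 2)" by simp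
    moreover have "real (m + 2) = real (m + 1) + 1" by simp
    ultimately show ?thesis using eq[of "real (m + 1)" "?c ^ (m + 2)"] by simp
  qed
  finally show ?thesis .
qed

lemma Gamma_half_integer:
  "Gamma (real k + 1/2) = sqrt pi * (fact (2 * k) / (2 ^ (2 * k) * fact k))"
proof (induction k)
  case 0
  then show ?case by (simp add: Gamma_one_half_real)
next
  case (Suc k)
  have "Gamma (real (Suc k) + 1/2) = Gamma ((real k + 1/2) + 1)" by (simp add: algebra_simps)
  also have "\<dots> = (real k + 1/2) * Gamma (real k + 1/2)"
    by (intro Gamma_plus1) (auto elim!: nonpos_Ints_cases)
  also have "\<dots> = (real k + 1/2) * (sqrt pi * (fact (2 * k) / (2 ^ (2 * k) * fact k)))"
    by (simp only: Suc)
  also have "\<dots> = sqrt pi * (fact (2 * Suc k) / (2 ^ (2 * Suc k) * fact (Suc k)))"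
    by (simp add: divide_simps) (simp add: algebra_simps)
  finally show ?case .
qed

lemma nn_integral_gaussian_moment:
  "(\<integral>\<^sup>+x. ennreal (x ^ m * exp (- x\<^sup>2)) * indicator {0<..} x \<partial>lborel) = ennreal (Gamma ((real m + 1) / 2) / 2)"
proof -
  have "has_bochner_integral lborel (\<lambda>x::real. indicator {0..} x *\<^sub>R (exp (-x\<^sup>2) * x ^ m)) (Gamma ((real m + 1) / 2) / 2)"
  proof (cases "even m")
    case True
    then obtain k where "m = 2 * k" by blast
    then show ?thesis using gaussian_moment_even_pos[of k] Gamma_half_integer[of k] by (simp add: add_divide_distrib ac_simps)
  next
    case False
    then obtain k where k: "m = 2 * k + 1" using oddE by blast
    have "(real m + 1) / 2 = 1 + real k" by (simp add: k)
    show ?thesis using gaussian_moment_odd_pos[of k] Gamma_fact[of k, where 'a=real]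
      unfolding \<open>(real m + 1) / 2 = 1 + real k\<close> by (simp add: k)
  qed
  then have "(\<integral>\<^sup>+x. ennreal (indicator {0..} x *\<^sub>R (exp (-x\<^sup>2) * x ^ m)) \<partial>lborel) = ennreal (Gamma ((real m + 1) / 2) / 2)"
    by (intro nn_integral_eq_integral[THEN trans]) (auto simp: has_bochner_integral_iff indicator_def)
  moreover have "(\<integral>\<^sup>+x. ennreal (x ^ m * exp (- x\<^sup>2)) * indicator {0<..} x \<partial>lborel)
     = (\<integral>\<^sup>+x. ennreal (indicator {0..} x *\<^sub>R (exp (-x\<^sup>2) * x ^ m)) \<partial>lborel)"
    using AE_lborel_singleton[of "0::real"] by (intro nn_integral_cong_AE) (auto simp: indicator_def mult.commute)
  ultimately show ?thesis by simp
qed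

lemma nn_integral_gaussian_moment_scaled:
  assumes "e > 0"
  shows "(\<integral>\<^sup>+x. ennreal (x ^ m * exp (- (e * x)\<^sup>2)) * indicator {0<..} x \<partial>lborel) 
    = ennreal (Gamma ((real m + 1) / 2) / (2 * e ^ Suc m))"
proof -
  let ?f = "\<lambda>x. ennreal (x ^ m * exp (- x\<^sup>2)) * indicator {0<..} x"
  have "integral\<^sup>N lborel ?f = \<bar>e\<bar> * (\<integral>\<^sup>+x. ?f (0 + e * x) \<partial>lborel)"
    using assms by (intro nn_integral_real_affine) auto
  also have "(\<integral>\<^sup>+x. ?f (0 + e * x) \<partial>lborel) = (\<integral>\<^sup>+x. ennreal (e ^ m) * (ennreal (x ^ m * exp (- (e * x)\<^sup>2)) * indicator {0<..} x) \<partial>lborel)"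
    using assms by (intro nn_integral_cong) (auto simp: indicator_def power_mult_distrib ennreal_mult'[symmetric] zero_less_mult_iff mult.assoc)
  also have "\<dots> = ennreal (e ^ m) * (\<integral>\<^sup>+x. ennreal (x ^ m * exp (- (e * x)\<^sup>2)) * indicator {0<..} x \<partial>lborel)"
    by (rule nn_integral_cmult) auto
  finally have "ennreal (e ^ Suc m) * (\<integral>\<^sup>+x. ennreal (x ^ m * exp (- (e * x)\<^sup>2)) * indicator {0<..} x \<partial>lborel) = ennreal (Gamma ((real m + 1) / 2) / 2)"
    using assms by (simp add: nn_integral_gaussian_moment ennreal_mult mult.assoc)
  also have "\<dots> = ennreal (e ^ Suc m) * ennreal (Gamma ((real m + 1) / 2) / (2 * e ^ Suc m))"
    using assms by (simp add: ennreal_mult'[symmetric] del: power_Suc)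
  finally show ?thesis
    using assms by (simp add: ennreal_mult_cancel_left)
qed

section \<open>Gaussian means over faces\<close>

lemma borel_measurable_gauss_int [measurable]: "gauss_int \<in> borel_measurable borel"
proof (rule borel_measurable_mono, rule monoI)
  fix a b :: real assume "a \<le> b"
  have "integral {-1..a} (\<lambda>x. exp (- x\<^sup>2)) \<le> integral {-1..b} (\<lambda>x. exp (- x\<^sup>2))"
    using \<open>a \<le> b\<close> by (intro integral_subset_le) (auto intro!: integrable_continuous_interval continuous_intros)
  then show "gauss_int a \<le> gauss_int b" by (simp add: gauss_int_def)
qed

text \<open>
  The difference of the two sides is \<open>2 s (1 - s) (p \<bullet> y - |p|^2)\<close>.
\<close>
lemma norm_towards_ge:
  fixes p y :: "'a::real_inner"
  assumes "(norm p)\<^sup>2 \<le> p \<bullet> y" "0 \<le> s" "s \<le> 1"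
  shows "(1 - s\<^sup>2) * (norm p)\<^sup>2 + s\<^sup>2 * (norm y)\<^sup>2 \<le> (norm (p + s *\<^sub>R (y - p)))\<^sup>2"
proof -
  have "(norm (p + s *\<^sub>R (y - p)))\<^sup>2
      = (1 - s\<^sup>2) * (norm p)\<^sup>2 + s\<^sup>2 * (norm y)\<^sup>2 + 2 * (s * (1 - s)) * (p \<bullet> y - (norm p)\<^sup>2)"
    unfolding power2_norm_eq_inner inner_add_left inner_add_right inner_diff_left inner_diff_right
      inner_scaleR_left inner_scaleR_right inner_commute[of y p]
    by (simp add: power2_eq_square algebra_simps)
  then show ?thesis using assms by simp
qed

text \<open>
  The variational characterisation of the point of a convex set that is nearest to the origin.
\<close>
lemma nearest_point_face:
  fixes F :: "'a::euclidean_space set"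
  assumes "polytope F" "F \<noteq> {}"
  obtains p where "p \<in> F" "\<And>y. y \<in> F \<Longrightarrow> (norm p)\<^sup>2 \<le> p \<bullet> y"
proof -
  have F: "convex F" "closed F" using assms polytope_imp_convex polytope_imp_closed by auto
  show ?thesis
  proof (rule that)
    show "closest_point F 0 \<in> F" using F assms by (intro closest_point_in_set)
    fix y assume "y \<in> F"
    from closest_point_dot[OF F this, of 0]
    show "(norm (closest_point F 0))\<^sup>2 \<le> closest_point F 0 \<bullet> y"
      by (simp add: power2_norm_eq_inner inner_diff_right)
  qed
qed

lemma face_integral_towards_le:
  fixes p :: "'a::euclidean_space"
  assumes p: "\<And>y. y \<in> G \<Longrightarrow> (norm p)\<^sup>2 \<le> p \<bullet> y" and k: "k \<le> (norm p)\<^sup>2"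
    and t: "0 \<le> t" "t \<le> 1" and G: "G \<in> sets borel"
  shows "face_integral G (\<lambda>y. ennreal (exp (- b\<^sup>2 * (norm (p + t *\<^sub>R (y - p)))\<^sup>2)))
    \<le> ennreal (exp (- (b\<^sup>2 - (b * t)\<^sup>2) * k)) * face_integral G (\<lambda>y. ennreal (exp (- (b * t)\<^sup>2 * (norm y)\<^sup>2)))"
proof -
  have "- b\<^sup>2 * (norm (p + t *\<^sub>R (y - p)))\<^sup>2 \<le> - (b\<^sup>2 - (b * t)\<^sup>2) * k + - (b * t)\<^sup>2 * (norm y)\<^sup>2" if "y \<in> G" for y
  proof -
    have "t\<^sup>2 \<le> 1" using t by (simp add: power_le_one)
    then have "(1 - t\<^sup>2) * k + t\<^sup>2 * (norm y)\<^sup>2 \<le> (1 - t\<^sup>2) * (norm p)\<^sup>2 + t\<^sup>2 * (norm y)\<^sup>2"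
      using k by (intro add_mono mult_left_mono) auto
    also have "\<dots> \<le> (norm (p + t *\<^sub>R (y - p)))\<^sup>2" using norm_towards_ge[OF p[OF that] t] .
    finally have "b\<^sup>2 * ((1 - t\<^sup>2) * k + t\<^sup>2 * (norm y)\<^sup>2) \<le> b\<^sup>2 * (norm (p + t *\<^sub>R (y - p)))\<^sup>2"
      by (intro mult_left_mono) auto
    then show ?thesis by (simp add: power_mult_distrib algebra_simps)
  qed
  then show ?thesis
    by (subst face_integral_cmult[symmetric])
       (auto intro!: face_integral_mono simp: G ennreal_mult'[symmetric] exp_add[symmetric])
qed

text \<open>
  The number \<open>k + m - j\<close> is the codimension of \<open>G\<close> if \<open>k\<close> is that of \<open>F\<close>. For \<open>k \<ge> 0\<close> the
  right-hand side is the volume of \<open>F\<close> times the mean of \<open>exp (- b^2 |x|^2)\<close> over a cube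
  \<open>[-1,1]^m\<close> that lies in a flat at distance \<open>sqrt k\<close> from the origin and is centred at the foot of the
  perpendicular. The polytope \<open>F\<close> is cut into pyramids with apex its point nearest to the origin;
  the induction hypothesis applies to their bases with \<open>k + 1\<close> in place of \<open>k\<close> and with
  \<open>b s\<close> in place of \<open>b\<close>. For the cube all the inequalities are equalities, which is why the bound
  reproduces itself.
\<close>
lemma face_integral_gaussian_le:
  fixes F :: "'a::euclidean_space set"
  assumes "polytope F" "aff_dim F = int m" "b > 0"
    and "\<And>G j x. G face_of F \<Longrightarrow> aff_dim G = int j \<Longrightarrow> x \<in> G \<Longrightarrow> k + real m - real j \<le> (norm x)\<^sup>2"
  shows "face_integral F (\<lambda>x. ennreal (exp (- b\<^sup>2 * (norm x)\<^sup>2)))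
    \<le> ennreal (exp (- b\<^sup>2 * k) * (gauss_int b / b) ^ m) * face_volume F"
  using assms
proof (induction m arbitrary: F k b)
  case 0
  have F: "F face_of F" "F \<in> sets borel" using "0.prems"(1)
    by (auto simp: face_of_refl polytope_imp_convex borel_closed polytope_imp_closed)
  have "k \<le> (norm x)\<^sup>2" if "x \<in> F" for x using "0.prems"(4)[OF F(1) "0.prems"(2) that] by simp
  then have "b\<^sup>2 * k \<le> b\<^sup>2 * (norm x)\<^sup>2" if "x \<in> F" for x using that by (intro mult_left_mono) auto
  then have "face_integral F (\<lambda>x. ennreal (exp (- b\<^sup>2 * (norm x)\<^sup>2)))
    \<le> face_integral F (\<lambda>x. ennreal (exp (- b\<^sup>2 * k)))"
    by (intro face_integral_mono) auto
  then show ?case using F by (simp add: face_integral_const)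
next
  case (Suc m)
  note F = Suc.prems(1,2) and b = Suc.prems(3)
  have refl: "F face_of F" using F by (simp add: face_of_refl polytope_imp_convex)
  have "F \<noteq> {}" using F by auto
  then obtain p where p: "p \<in> F" "\<And>y. y \<in> F \<Longrightarrow> (norm p)\<^sup>2 \<le> p \<bullet> y"
    using nearest_point_face F(1) by metis
  have kp: "k \<le> (norm p)\<^sup>2" using Suc.prems(4)[OF refl F(2) p(1)] by simp
  \<comment> \<open>The part of the bound for a pyramid that does not depend on the height parameter \<open>s\<close>.\<close>
  define C where "C = exp (- b\<^sup>2 * k) / b ^ m"
  have C0: "C \<ge> 0" using b by (simp add: C_def)
  have facet: "(\<integral>\<^sup>+s. indicator {0<..1} s * ennreal (s ^ m) *
           face_integral G (\<lambda>y. ennreal (exp (- b\<^sup>2 * (norm (p + s *\<^sub>R (y - p)))\<^sup>2))) \<partial>lborel)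
        \<le> ennreal (C * (gauss_int b ^ Suc m / (real (Suc m) * b))) * face_volume G" if G: "G facet_of F" for G
  proof -
    note GF = polytope_facet_borel[OF F(1) G F(2)]
    have IH: "face_integral G (\<lambda>x. ennreal (exp (- (b * s)\<^sup>2 * (norm x)\<^sup>2)))
       \<le> ennreal (exp (- (b * s)\<^sup>2 * (k + 1)) * (gauss_int (b * s) / (b * s)) ^ m) * face_volume G" if "s > 0" for s
    proof (rule Suc.IH[OF GF(4,2)])
      show "0 < b * s" using b that by simp
      fix H j x assume H: "H face_of G" "aff_dim H = int j" "x \<in> H"
      then show "k + 1 + real m - real j \<le> (norm x)\<^sup>2"
        using Suc.prems(4)[of H j x] face_of_trans[OF H(1) GF(5)] by simp
    qed
    have pointwise: "indicator {0<..1} s * ennreal (s ^ m) *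
           face_integral G (\<lambda>y. ennreal (exp (- b\<^sup>2 * (norm (p + s *\<^sub>R (y - p)))\<^sup>2)))
        \<le> ennreal C * (indicator {0<..1} s * ennreal (exp (- (b * s)\<^sup>2) * gauss_int (b * s) ^ m)) * face_volume G" for s
    proof (cases "s \<in> {0<..1}")
      case True
      have "face_integral G (\<lambda>y. ennreal (exp (- b\<^sup>2 * (norm (p + s *\<^sub>R (y - p)))\<^sup>2)))
         \<le> ennreal (exp (- (b\<^sup>2 - (b * s)\<^sup>2) * k)) * face_integral G (\<lambda>y. ennreal (exp (- (b * s)\<^sup>2 * (norm y)\<^sup>2)))"
        using True GF p kp by (intro face_integral_towards_le) auto
      also have "\<dots> \<le> ennreal (exp (- (b\<^sup>2 - (b * s)\<^sup>2) * k)) *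
         (ennreal (exp (- (b * s)\<^sup>2 * (k + 1)) * (gauss_int (b * s) / (b * s)) ^ m) * face_volume G)"
        using True by (intro mult_left_mono IH) auto
      finally have "ennreal (s ^ m) * face_integral G (\<lambda>y. ennreal (exp (- b\<^sup>2 * (norm (p + s *\<^sub>R (y - p)))\<^sup>2)))
         \<le> ennreal (s ^ m) * (ennreal (exp (- (b\<^sup>2 - (b * s)\<^sup>2) * k)) *
         (ennreal (exp (- (b * s)\<^sup>2 * (k + 1)) * (gauss_int (b * s) / (b * s)) ^ m) * face_volume G))"
        by (intro mult_left_mono) auto
      also have "\<dots> = ennreal (s ^ m * (exp (- (b\<^sup>2 - (b * s)\<^sup>2) * k) * (exp (- (b * s)\<^sup>2 * (k + 1)) * (gauss_int (b * s) / (b * s)) ^ m))) * face_volume G"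
        using True b by (simp add: ennreal_mult'[symmetric] mult.assoc[symmetric] gauss_int_nonneg)
      also have "s ^ m * (exp (- (b\<^sup>2 - (b * s)\<^sup>2) * k) * (exp (- (b * s)\<^sup>2 * (k + 1)) * (gauss_int (b * s) / (b * s)) ^ m))
         = s ^ m * (exp (- (b\<^sup>2 - (b * s)\<^sup>2) * k + - (b * s)\<^sup>2 * (k + 1)) * (gauss_int (b * s) / (b * s)) ^ m)"
        by (simp only: exp_add mult.assoc)
      also have "- (b\<^sup>2 - (b * s)\<^sup>2) * k + - (b * s)\<^sup>2 * (k + 1) = - b\<^sup>2 * k + - (b * s)\<^sup>2"
        by (simp add: algebra_simps)
      also have "s ^ m * (exp (- b\<^sup>2 * k + - (b * s)\<^sup>2) * (gauss_int (b * s) / (b * s)) ^ m)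
         = C * (exp (- (b * s)\<^sup>2) * gauss_int (b * s) ^ m)"
        using True b by (simp only: exp_add C_def power_divide power_mult_distrib) (simp add: field_simps)
      finally show ?thesis using True C0 by (simp add: ennreal_mult')
    qed auto
    have "(\<integral>\<^sup>+s. indicator {0<..1} s * ennreal (s ^ m) *
           face_integral G (\<lambda>y. ennreal (exp (- b\<^sup>2 * (norm (p + s *\<^sub>R (y - p)))\<^sup>2))) \<partial>lborel)
        \<le> (\<integral>\<^sup>+s. ennreal C * (indicator {0<..1} s * ennreal (exp (- (b * s)\<^sup>2) * gauss_int (b * s) ^ m)) * face_volume G \<partial>lborel)"
      by (intro nn_integral_mono pointwise)
    also have "\<dots> = ennreal C * ennreal (gauss_int b ^ Suc m / (real (Suc m) * b)) * face_volume G"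
      using b by (simp add: nn_integral_multc nn_integral_cmult nn_integral_gauss_int_power del: power_Suc of_nat_Suc)
    finally show ?thesis by (simp only: ennreal_mult'[OF C0])
  qed
  let ?D = "ennreal (C * (gauss_int b ^ Suc m / (real (Suc m) * b)))"
  have "face_integral F (\<lambda>x. ennreal (exp (- b\<^sup>2 * (norm x)\<^sup>2)))
    \<le> (\<Sum>G | G facet_of F. ennreal (infdist p (affine hull G)) *
        (\<integral>\<^sup>+s. indicator {0<..1} s * ennreal (s ^ m) *
           face_integral G (\<lambda>y. ennreal (exp (- b\<^sup>2 * (norm (p + s *\<^sub>R (y - p)))\<^sup>2))) \<partial>lborel))"
    by (rule face_integral_le_facets[OF F p(1)]) measurable
  also have "\<dots> \<le> (\<Sum>G | G facet_of F. ennreal (infdist p (affine hull G)) * (?D * face_volume G))"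
    using facet by (intro sum_mono mult_left_mono) auto
  also have "\<dots> = ?D * (\<Sum>G | G facet_of F. ennreal (infdist p (affine hull G)) * face_volume G)"
    by (simp only: sum_distrib_left mult.left_commute[of ?D])
  also have "\<dots> \<le> ?D * (ennreal (real (Suc m)) * face_volume F)"
    by (intro mult_left_mono face_volume_ge_facets[OF F p(1)]) auto
  also have "\<dots> = ennreal (exp (- b\<^sup>2 * k) * (gauss_int b / b) ^ Suc m) * face_volume F"
  proof -
    have "?D * ennreal (real (Suc m)) = ennreal (C * (gauss_int b ^ Suc m / (real (Suc m) * b)) * real (Suc m))"
      by (rule ennreal_mult''[symmetric]) simp
    also have "C * (gauss_int b ^ Suc m / (real (Suc m) * b)) * real (Suc m) = C * (gauss_int b ^ Suc m / b)"
      by (simp del: of_nat_Suc power_Suc)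
    also have "\<dots> = exp (- b\<^sup>2 * k) * (gauss_int b / b) ^ Suc m"
      using b by (simp add: C_def power_divide field_simps)
    finally show ?thesis by (simp add: mult.assoc[symmetric] del: of_nat_Suc power_Suc)
  qed
  finally show ?case .
qed

text \<open>
  With \<open>s = b + \<sigma> / sqrt P\<close> the integral times \<open>sqrt P\<close> becomes that of
  \<open>exp (- \<sigma>^2 - 2 b sqrt P \<sigma>)\<close> over \<open>\<sigma> \<ge> 0\<close>, which decreases in \<open>P\<close>. So the worst case is \<open>P = 1\<close>.
\<close>
lemma gaussian_tail_scaled_le:
  assumes "0 \<le> b" "1 \<le> P" "0 \<le> h" "h\<^sup>2 \<le> P"
  shows "ennreal h * (\<integral>\<^sup>+s. ennreal (exp (- (s\<^sup>2 - b\<^sup>2) * P)) * indicator {b..} s \<partial>lborel)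
    \<le> ennreal ((sqrt pi / 2 - gauss_int b) * exp (b\<^sup>2))"
proof -
  let ?f = "\<lambda>P s. ennreal (exp (- (s\<^sup>2 - b\<^sup>2) * P)) * indicator {b..} s"
  have eq: "ennreal (sqrt P) * integral\<^sup>N lborel (?f P) = (\<integral>\<^sup>+s. ennreal (exp (- s\<^sup>2 - 2 * b * sqrt P * s)) * indicator {0..} s \<partial>lborel)" 
    if P: "P \<ge> 1" for P
  proof -
    define r where "r = sqrt P"
    have r: "r > 0" "P = r\<^sup>2" using P by (auto simp: r_def)
    have "integral\<^sup>N lborel (?f P) = \<bar>1 / r\<bar> * (\<integral>\<^sup>+s. ?f P (b + (1 / r) * s) \<partial>lborel)"
      using r by (intro nn_integral_real_affine) auto
    also have "(\<integral>\<^sup>+s. ?f P (b + (1 / r) * s) \<partial>lborel) = (\<integral>\<^sup>+s. ennreal (exp (- s\<^sup>2 - 2 * b * r * s)) * indicator {0..} s \<partial>lborel)"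
    proof (intro nn_integral_cong)
      fix s
      have "- ((b + (1 / r) * s)\<^sup>2 - b\<^sup>2) * P = - s\<^sup>2 - 2 * b * r * s"
        using r by (simp add: power2_eq_square field_simps)
      then show "?f P (b + (1 / r) * s) = ennreal (exp (- s\<^sup>2 - 2 * b * r * s)) * indicator {0..} s"
        using r by (auto simp: indicator_def zero_le_divide_iff)
    qed
    finally show ?thesis using r
      by (simp add: r_def[symmetric] mult.assoc[symmetric] ennreal_mult'[symmetric])
  qed
  have "h \<le> sqrt P" using assms by (simp add: real_le_rsqrt)
  then have "ennreal h * integral\<^sup>N lborel (?f P) \<le> ennreal (sqrt P) * integral\<^sup>N lborel (?f P)"
    by (intro mult_right_mono ennreal_leI) auto
  also have "\<dots> = (\<integral>\<^sup>+s. ennreal (exp (- s\<^sup>2 - 2 * b * sqrt P * s)) * indicator {0..} s \<partial>lborel)"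
    using eq assms by simp
  also have "\<dots> \<le> (\<integral>\<^sup>+s. ennreal (exp (- s\<^sup>2 - 2 * b * sqrt 1 * s)) * indicator {0..} s \<partial>lborel)"
  proof (intro nn_integral_mono)
    fix s
    have "2 * b * sqrt 1 * s \<le> 2 * b * sqrt P * s" if "s \<ge> 0"
      using assms that by (intro mult_right_mono mult_left_mono) auto
    then show "ennreal (exp (- s\<^sup>2 - 2 * b * sqrt P * s)) * indicator {0..} s \<le> ennreal (exp (- s\<^sup>2 - 2 * b * sqrt 1 * s)) * indicator {0..} s"
      by (auto simp: indicator_def)
  qed
  also have "\<dots> = integral\<^sup>N lborel (?f 1)" using eq[of 1] by simp
  also have "\<dots> = (\<integral>\<^sup>+s. ennreal (exp (b\<^sup>2)) * (ennreal (exp (- s\<^sup>2)) * indicator {b..} s) \<partial>lborel)"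
    by (intro nn_integral_cong) (auto simp: indicator_def ennreal_mult'[symmetric] exp_add[symmetric])
  also have "\<dots> = ennreal ((sqrt pi / 2 - gauss_int b) * exp (b\<^sup>2))"
    using assms by (simp add: nn_integral_cmult nn_integral_gauss_tail ennreal_mult'[symmetric])
      (simp add: mult.commute)
  finally show ?thesis .
qed

text \<open>
  On the left, \<open>s\<close> is the parameter of a cone with apex \<open>0\<close> over a facet and \<open>t\<close> that of a pyramid in
  the facet over a ridge; \<open>h\<close> and \<open>sqrt P\<close> stand for the distances of the origin from the affine hull
  of the facet and from the facet itself. A point of the ridge ends up scaled by \<open>b = s t\<close>. With \<open>b\<close>
  as a variable in place of \<open>t\<close> the integration over \<open>s\<close> can be carried out, and the facet
  disappears from the bound.
\<close>
lemma nn_integral_fold_cones_le: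
  assumes [measurable]: "j \<in> borel_measurable borel" and P: "1 \<le> P" "0 \<le> h" "h\<^sup>2 \<le> P"
  shows "ennreal h * (\<integral>\<^sup>+s. indicator {0<..} s * ennreal (s ^ Suc m) *
      (\<integral>\<^sup>+t. indicator {0<..1} t * ennreal (t ^ m) * (ennreal (exp (- (s\<^sup>2 - (s * t)\<^sup>2) * P)) * j (s * t)) \<partial>lborel) \<partial>lborel)
    \<le> (\<integral>\<^sup>+b. ennreal (b ^ m * ((sqrt pi / 2 - gauss_int b) * exp (b\<^sup>2))) * j b * indicator {0<..} b \<partial>lborel)"
proof -
  let ?\<psi> = "\<lambda>s b. indicator {b. 0 < b \<and> b \<le> s} b * ennreal (b ^ m) * (ennreal (exp (- (s\<^sup>2 - b\<^sup>2) * P)) * j b)"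
  have [measurable]: "(\<lambda>(s, b). ?\<psi> s b) \<in> borel_measurable (lborel \<Otimes>\<^sub>M lborel)"
  proof -
    have "(\<lambda>(s, b). ?\<psi> s b) = (\<lambda>x. (if 0 < snd x \<and> snd x \<le> fst x then 1 else 0) * ennreal (snd x ^ m) * (ennreal (exp (- ((fst x)\<^sup>2 - (snd x)\<^sup>2) * P)) * j (snd x)))"
      by (auto simp: fun_eq_iff indicator_def)
    moreover have "\<dots> \<in> borel_measurable (lborel \<Otimes>\<^sub>M lborel)" by measurable
    ultimately show ?thesis by simp
  qed
  have inner: "indicator {0<..} s * ennreal (s ^ Suc m) *
      (\<integral>\<^sup>+t. indicator {0<..1} t * ennreal (t ^ m) * (ennreal (exp (- (s\<^sup>2 - (s * t)\<^sup>2) * P)) * j (s * t)) \<partial>lborel)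
     = (\<integral>\<^sup>+b. ?\<psi> s b \<partial>lborel)" for s
  proof (cases "s > 0")
    case True
    have "(\<integral>\<^sup>+b. ?\<psi> s b \<partial>lborel) = \<bar>s\<bar> * (\<integral>\<^sup>+t. ?\<psi> s (0 + s * t) \<partial>lborel)"
      using True by (intro nn_integral_real_affine) auto
    also have "(\<integral>\<^sup>+t. ?\<psi> s (0 + s * t) \<partial>lborel)
      = (\<integral>\<^sup>+t. ennreal (s ^ m) * (indicator {0<..1} t * ennreal (t ^ m) * (ennreal (exp (- (s\<^sup>2 - (s * t)\<^sup>2) * P)) * j (s * t))) \<partial>lborel)"
      using True by (intro nn_integral_cong)
        (auto simp: indicator_def power_mult_distrib ennreal_mult zero_less_mult_iff mult.assoc)
    also have "\<dots> = ennreal (s ^ m) * (\<integral>\<^sup>+t. indicator {0<..1} t * ennreal (t ^ m) * (ennreal (exp (- (s\<^sup>2 - (s * t)\<^sup>2) * P)) * j (s * t)) \<partial>lborel)"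
      by (rule nn_integral_cmult) measurable
    finally show ?thesis using True by (simp add: ennreal_mult mult.assoc)
  next
    case False
    then have "(\<integral>\<^sup>+b. ?\<psi> s b \<partial>lborel) = (\<integral>\<^sup>+b. 0 \<partial>(lborel :: real measure))"
      by (intro nn_integral_cong) (auto simp: indicator_def)
    then show ?thesis using False by (simp add: indicator_def)
  qed
  have "ennreal h * (\<integral>\<^sup>+s. indicator {0<..} s * ennreal (s ^ Suc m) *
      (\<integral>\<^sup>+t. indicator {0<..1} t * ennreal (t ^ m) * (ennreal (exp (- (s\<^sup>2 - (s * t)\<^sup>2) * P)) * j (s * t)) \<partial>lborel) \<partial>lborel)
     = ennreal h * (\<integral>\<^sup>+s. (\<integral>\<^sup>+b. ?\<psi> s b \<partial>lborel) \<partial>lborel)"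
    by (simp only: inner)
  also have "(\<integral>\<^sup>+s. (\<integral>\<^sup>+b. ?\<psi> s b \<partial>lborel) \<partial>lborel) = (\<integral>\<^sup>+b. (\<integral>\<^sup>+s. ?\<psi> s b \<partial>lborel) \<partial>lborel)"
    by (rule lborel_pair.Fubini') simp
  also have "\<dots> = (\<integral>\<^sup>+b. ennreal (b ^ m) * j b * indicator {0<..} b *
       (\<integral>\<^sup>+s. ennreal (exp (- (s\<^sup>2 - b\<^sup>2) * P)) * indicator {b..} s \<partial>lborel) \<partial>lborel)"
  proof (intro nn_integral_cong)
    fix b :: real
    show "(\<integral>\<^sup>+s. ?\<psi> s b \<partial>lborel) = ennreal (b ^ m) * j b * indicator {0<..} b *
       (\<integral>\<^sup>+s. ennreal (exp (- (s\<^sup>2 - b\<^sup>2) * P)) * indicator {b..} s \<partial>lborel)"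
      by (subst nn_integral_cmult[symmetric]) (auto intro!: nn_integral_cong simp: indicator_def ac_simps)
  qed
  also have "ennreal h * \<dots> = (\<integral>\<^sup>+b. ennreal h * (ennreal (b ^ m) * j b * indicator {0<..} b *
       (\<integral>\<^sup>+s. ennreal (exp (- (s\<^sup>2 - b\<^sup>2) * P)) * indicator {b..} s \<partial>lborel)) \<partial>lborel)"
  proof (rule nn_integral_cmult[symmetric])
    have "(\<lambda>b. \<integral>\<^sup>+s. ennreal (exp (- (s\<^sup>2 - b\<^sup>2) * P)) * (if b \<le> s then 1 else 0) \<partial>lborel) \<in> borel_measurable lborel"
      by measurable
    moreover have "indicator {b..} s = (if b \<le> s then 1 else (0::ennreal))" for b s :: real by simp
    ultimately show "(\<lambda>b. ennreal (b ^ m) * j b * indicator {0<..} b *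
       (\<integral>\<^sup>+s. ennreal (exp (- (s\<^sup>2 - b\<^sup>2) * P)) * indicator {b..} s \<partial>lborel)) \<in> borel_measurable lborel"
      by simp
  qed
  also have "\<dots> \<le> (\<integral>\<^sup>+b. ennreal (b ^ m * ((sqrt pi / 2 - gauss_int b) * exp (b\<^sup>2))) * j b * indicator {0<..} b \<partial>lborel)"
  proof (intro nn_integral_mono)
    fix b :: real
    show "ennreal h * (ennreal (b ^ m) * j b * indicator {0<..} b *
       (\<integral>\<^sup>+s. ennreal (exp (- (s\<^sup>2 - b\<^sup>2) * P)) * indicator {b..} s \<partial>lborel))
       \<le> ennreal (b ^ m * ((sqrt pi / 2 - gauss_int b) * exp (b\<^sup>2))) * j b * indicator {0<..} b"
    proof (cases "b > 0")
      case True
      have "ennreal (b ^ m) * j b * (ennreal h * (\<integral>\<^sup>+s. ennreal (exp (- (s\<^sup>2 - b\<^sup>2) * P)) * indicator {b..} s \<partial>lborel))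
        \<le> ennreal (b ^ m) * j b * ennreal ((sqrt pi / 2 - gauss_int b) * exp (b\<^sup>2))"
        using True P by (intro mult_left_mono gaussian_tail_scaled_le) auto
      then show ?thesis using True by (simp add: ennreal_mult' ac_simps)
    qed simp
  qed
  finally show ?thesis .
qed

section \<open>The contribution of a facet\<close>

text \<open>
  The contribution of a flag of the cube \<open>[-1,1]^(m+2)\<close>, divided by the volume of its ridge.
\<close>
definition cube_const :: "nat \<Rightarrow> real" where
  "cube_const m = (sqrt pi / 2) ^ (m + 2) / (real (m + 1) * real (m + 2))"

text \<open>
  The distance \<open>\<rho>\<close> between apex and ridge at which the two bounds for the contribution of a flag
  coincide.
\<close>
definition ridge_scale :: "nat \<Rightarrow> real" where
  "ridge_scale m = (real (m + 2) * Gamma ((real m + 3) / 2) / (sqrt pi / 2) ^ (m + 1)) powr (1 / real (m + 1))"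

lemma Gamma_step: "Gamma ((real m + 3) / 2) = (real m + 1) / 2 * Gamma ((real m + 1) / 2)"
proof -
  have "Gamma ((real m + 1) / 2 + 1) = (real m + 1) / 2 * Gamma ((real m + 1) / 2)"
    by (intro Gamma_plus1) (auto elim!: nonpos_Ints_cases)
  moreover have "(real m + 1) / 2 + 1 = (real m + 3) / 2" by simp
  ultimately show ?thesis by metis
qed

lemma ridge_scale_pos: "ridge_scale m > 0"
proof -
  have "Gamma ((real m + 3) / 2) > 0" by (intro Gamma_real_pos) auto
  then have "Gamma ((real m + 3) / 2) \<noteq> 0" by (metis less_irrefl)
  then show ?thesis by (simp add: ridge_scale_def)
qed

lemma ridge_scale_power:
  "ridge_scale m ^ Suc m = real (m + 2) * Gamma ((real m + 3) / 2) / (sqrt pi / 2) ^ (m + 1)"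
proof -
  have "Gamma ((real m + 3) / 2) > 0" by (intro Gamma_real_pos) auto
  then have pos: "real (m + 2) * Gamma ((real m + 3) / 2) / (sqrt pi / 2) ^ (m + 1) > 0" by simp
  have "ridge_scale m ^ Suc m = ridge_scale m powr real (Suc m)"
    by (rule powr_realpow[symmetric, OF ridge_scale_pos])
  then show ?thesis using pos by (simp add: ridge_scale_def powr_powr)
qed

text \<open>
  At \<open>d = \<rho>\<close> the bound \<open>d K\<close> agrees with the bound
  \<open>(sqrt pi / 2) \<Gamma>((m+1)/2) / (2 d^m)\<close>; this is the equation that determines \<open>\<rho>\<close>.
\<close>
lemma ridge_scale_cube_const:
  "ridge_scale m * cube_const m = sqrt pi / 2 * Gamma ((real m + 1) / 2) / (2 * ridge_scale m ^ m)"
proof -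
  let ?c = "sqrt pi / 2" and ?\<Gamma> = "Gamma ((real m + 1) / 2)"
  have "ridge_scale m ^ Suc m * cube_const m
     = (real (m + 2) * ((real m + 1) / 2 * ?\<Gamma>) / ?c ^ (m + 1)) * (?c ^ (m + 2) / (real (m + 1) * real (m + 2)))"
    unfolding ridge_scale_power cube_const_def Gamma_step ..
  also have "\<dots> = ?c * ?\<Gamma> / 2"
  proof -
    have *: "(B * (A / 2 * g) / x) * (c * x / (A * B)) = c * g / 2" if "A > 0" "B > 0" "x > 0" for A B x g c :: real
      using that by (simp add: field_simps)
    have eq: "real (m + 1) = real m + 1" "?c ^ (m + 2) = ?c * ?c ^ (m + 1)" by simp_all
    show ?thesis unfolding eq by (rule *) auto
  qed
  finally show ?thesis
    using ridge_scale_pos[of m] by (simp add: field_simps)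
qed

text \<open>
  Collecting all \<open>(n-1)\<close>-th roots, the factor \<open>\<Gamma>((n+1)/2)\<close> in \<open>\<rho>^(n-1)\<close> cancels against the one in the
  volume of the unit ball.
\<close>
lemma ridge_scale_bound:
  "ridge_scale m * ridge_bound (m + 2) = real (m + 1) * real (m + 2) * 2 ^ (m + 1)"
proof -
  define N where "N = real (m + 1)"
  define n where "n = real (m + 2)"
  let ?\<Gamma> = "Gamma ((real m + 3) / 2)" and ?c = "sqrt pi / 2"
  have N: "N > 0" "n > 0" "n - 1 = N" "n - 2 = N - 1" by (auto simp: N_def n_def)
  have G: "?\<Gamma> > 0" by (intro Gamma_real_pos) auto
  have \<kappa>: "unit_ball_vol N = sqrt pi ^ (m + 1) / ?\<Gamma>"
  proof -
    have "pi powr (N / 2) = sqrt pi ^ (m + 1)"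
    proof -
      have "sqrt pi ^ (m + 1) = (pi powr (1 / 2)) powr N"
        by (simp add: N_def powr_half_sqrt powr_realpow del: power_Suc flip: of_nat_Suc)
      then show ?thesis by (simp add: powr_powr)
    qed
    moreover have "N / 2 + 1 = (real m + 3) / 2" by (simp add: N_def field_simps)
    ultimately show ?thesis by (simp only: unit_ball_vol_def)
  qed
  have \<kappa>0: "unit_ball_vol N > 0" using G by (simp add: \<kappa>)
  have q: "n * 2 ^ (m + 2) > 0" using N by simp
  have "(n * 2 ^ (m + 2)) powr ((N - 1) / N) = (n * 2 ^ (m + 2)) / (n * 2 ^ (m + 2)) powr (1 / N)"
    using N q by (simp add: diff_divide_distrib powr_diff)
  then have rb: "ridge_bound (m + 2) = N / 2 * (2 * unit_ball_vol N) powr (1 / N) * ((n * 2 ^ (m + 2)) / (n * 2 ^ (m + 2)) powr (1 / N))"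
    by (simp only: ridge_bound_def n_def[symmetric] N(3,4))
  have "ridge_scale m * ((2 * unit_ball_vol N) powr (1 / N) / (n * 2 ^ (m + 2)) powr (1 / N))
     = ((n * ?\<Gamma> / ?c ^ (m + 1)) * (2 * unit_ball_vol N / (n * 2 ^ (m + 2)))) powr (1 / N)"
  proof -
    have *: "a powr e * (b powr e / c powr e) = (a * (b / c)) powr e" if "a > 0" "b > 0" "c > 0" for a b c e :: real
      using that by (simp add: powr_mult powr_divide)
    have "n * ?\<Gamma> / ?c ^ (m + 1) > 0" using N G by simp
    then show ?thesis
      unfolding ridge_scale_def N_def[symmetric] n_def[symmetric] using \<kappa>0 q by (intro *) auto
  qed
  also have "(n * ?\<Gamma> / ?c ^ (m + 1)) * (2 * unit_ball_vol N / (n * 2 ^ (m + 2))) = 1"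
  proof -
    have *: "(n * g / (x / y)) * (2 * (x / g) / (n * (2 * y))) = 1" if "g > 0" "x > 0" "y > 0" for g x y :: real
      using that N by simp
    have eq: "?c ^ (m + 1) = sqrt pi ^ (m + 1) / 2 ^ (m + 1)" "(2::real) ^ (m + 2) = 2 * 2 ^ (m + 1)"
      by (simp_all only: power_divide) simp
    show ?thesis unfolding \<kappa> eq using G by (intro *) auto
  qed
  finally have "ridge_scale m * ((2 * unit_ball_vol N) powr (1 / N) / (n * 2 ^ (m + 2)) powr (1 / N)) = 1"
    by (simp only: powr_one_eq_one)
  moreover have "r * (N / 2 * x * (q / y)) = N / 2 * q * (r * (x / y))" for r x y q :: real by simp
  ultimately have "ridge_scale m * ridge_bound (m + 2) = N / 2 * (n * 2 ^ (m + 2))"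
    unfolding rb by (simp only: mult_1_right)
  then show ?thesis by (simp add: N_def n_def)
qed

text \<open>
  A bound for the mean of \<open>exp (- b^2 |y|^2)\<close> over a ridge at distance \<open>d\<close> from the apex in a facet:
  the comparison with the cube if \<open>d\<close> is small, the estimate \<open>|y|^2 \<ge> 1 + d^2\<close> if \<open>d\<close> is large.
\<close>
definition ridge_profile :: "nat \<Rightarrow> real \<Rightarrow> real \<Rightarrow> real" where
  "ridge_profile m d b = (if d \<le> ridge_scale m then exp (- b\<^sup>2 * 2) * (gauss_int b / b) ^ m
     else exp (- b\<^sup>2 * (1 + d\<^sup>2)))"

lemma ridge_profile_measurable [measurable]: "ridge_profile m d \<in> borel_measurable borel"
  unfolding ridge_profile_def by measurable

text \<open>
  If \<open>d \<le> \<rho>\<close>, the profile of the cube gives \<open>d K\<close> exactly. If \<open>d > \<rho>\<close>, the tail factor is estimated by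
  \<open>sqrt pi / 2\<close> and a moment of a Gaussian remains, which gives a multiple of \<open>d^(- m)\<close>.
\<close>
lemma ridge_profile_integral_le:
  assumes "d \<ge> 0"
  shows "ennreal d * (\<integral>\<^sup>+b. ennreal (b ^ m * ((sqrt pi / 2 - gauss_int b) * exp (b\<^sup>2))) * ennreal (ridge_profile m d b) * indicator {0<..} b \<partial>lborel)
    \<le> ennreal (ridge_scale m * cube_const m)" (is "ennreal d * ?I \<le> _")
proof (cases "d \<le> ridge_scale m")
  case True
  have "?I = (\<integral>\<^sup>+b. ennreal ((sqrt pi / 2 - gauss_int b) * exp (- b\<^sup>2) * gauss_int b ^ m) * indicator {0<..} b \<partial>lborel)"
  proof (intro nn_integral_cong)
    fix b :: real
    show "ennreal (b ^ m * ((sqrt pi / 2 - gauss_int b) * exp (b\<^sup>2))) * ennreal (ridge_profile m d b) * indicator {0<..} b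
       = ennreal ((sqrt pi / 2 - gauss_int b) * exp (- b\<^sup>2) * gauss_int b ^ m) * indicator {0<..} b"
    proof (cases "b > 0")
      case b: True
      have "b ^ m * ((sqrt pi / 2 - gauss_int b) * exp (b\<^sup>2)) * ridge_profile m d b
        = (sqrt pi / 2 - gauss_int b) * (exp (b\<^sup>2) * exp (- b\<^sup>2 * 2)) * gauss_int b ^ m"
        using True b by (simp add: ridge_profile_def power_divide)
      also have "exp (b\<^sup>2) * exp (- b\<^sup>2 * 2) = exp (- b\<^sup>2)" by (simp flip: exp_add)
      finally have eq: "b ^ m * ((sqrt pi / 2 - gauss_int b) * exp (b\<^sup>2)) * ridge_profile m d b
        = (sqrt pi / 2 - gauss_int b) * exp (- b\<^sup>2) * gauss_int b ^ m" .
      have "0 \<le> b ^ m * ((sqrt pi / 2 - gauss_int b) * exp (b\<^sup>2))"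
        using b gauss_int_le[of b] by simp
      from ennreal_mult'[OF this, of "ridge_profile m d b"] show ?thesis by (simp only: eq)
    qed simp
  qed
  also have "\<dots> = ennreal (cube_const m)" by (simp only: nn_integral_cube_constant cube_const_def)
  finally have "ennreal d * ?I = ennreal (d * cube_const m)" using assms by (simp add: ennreal_mult')
  also have "\<dots> \<le> ennreal (ridge_scale m * cube_const m)"
    using True by (intro ennreal_leI mult_right_mono) (auto simp: cube_const_def)
  finally show ?thesis .
next
  case False
  then have d: "d > ridge_scale m" "d > 0" using ridge_scale_pos[of m] by auto
  let ?\<Gamma> = "Gamma ((real m + 1) / 2)"
  have G: "?\<Gamma> > 0" by (intro Gamma_real_pos) auto
  have "?I \<le> (\<integral>\<^sup>+b. ennreal (sqrt pi / 2) * (ennreal (b ^ m * exp (- (d * b)\<^sup>2)) * indicator {0<..} b) \<partial>lborel)"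
  proof (intro nn_integral_mono)
    fix b :: real
    show "ennreal (b ^ m * ((sqrt pi / 2 - gauss_int b) * exp (b\<^sup>2))) * ennreal (ridge_profile m d b) * indicator {0<..} b
       \<le> ennreal (sqrt pi / 2) * (ennreal (b ^ m * exp (- (d * b)\<^sup>2)) * indicator {0<..} b)"
    proof (cases "b > 0")
      case b: True
      have "b ^ m * ((sqrt pi / 2 - gauss_int b) * exp (b\<^sup>2)) * ridge_profile m d b
        = (sqrt pi / 2 - gauss_int b) * (b ^ m * (exp (b\<^sup>2) * exp (- b\<^sup>2 * (1 + d\<^sup>2))))"
        using False by (simp add: ridge_profile_def)
      also have "exp (b\<^sup>2) * exp (- b\<^sup>2 * (1 + d\<^sup>2)) = exp (- (d * b)\<^sup>2)"
        by (simp add: power_mult_distrib algebra_simps flip: exp_add)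
      also have "(sqrt pi / 2 - gauss_int b) * (b ^ m * exp (- (d * b)\<^sup>2)) \<le> sqrt pi / 2 * (b ^ m * exp (- (d * b)\<^sup>2))"
        using b gauss_int_nonneg[of b] by (intro mult_right_mono) auto
      finally have "ennreal (b ^ m * ((sqrt pi / 2 - gauss_int b) * exp (b\<^sup>2)) * ridge_profile m d b)
         \<le> ennreal (sqrt pi / 2 * (b ^ m * exp (- (d * b)\<^sup>2)))"
        by (rule ennreal_leI)
      moreover have "0 \<le> b ^ m * ((sqrt pi / 2 - gauss_int b) * exp (b\<^sup>2))"
        using b gauss_int_le[of b] by simp
      moreover have "0 \<le> sqrt pi / 2" by simp
      ultimately show ?thesis using b by (simp only: ennreal_mult') simp
    qed simp
  qed
  also have "\<dots> = ennreal (sqrt pi / 2) * ennreal (?\<Gamma> / (2 * d ^ Suc m))"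
    using d(2) by (simp add: nn_integral_cmult nn_integral_gaussian_moment_scaled del: power_Suc)
  finally have "ennreal d * ?I \<le> ennreal d * (ennreal (sqrt pi / 2) * ennreal (?\<Gamma> / (2 * d ^ Suc m)))"
    by (intro mult_left_mono) auto
  also have "\<dots> = ennreal (d * (sqrt pi / 2 * (?\<Gamma> / (2 * d ^ Suc m))))"
    using d G by (simp add: ennreal_mult'[symmetric])
  also have "d * (sqrt pi / 2 * (?\<Gamma> / (2 * d ^ Suc m))) = sqrt pi / 2 * ?\<Gamma> / (2 * d ^ m)"
    using d by (simp add: field_simps)
  also have "\<dots> \<le> sqrt pi / 2 * ?\<Gamma> / (2 * ridge_scale m ^ m)"
    using d G ridge_scale_pos[of m] by (intro divide_left_mono mult_left_mono power_mono) auto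
  also have "\<dots> = ridge_scale m * cube_const m" by (rule ridge_scale_cube_const[symmetric])
  finally show ?thesis by (simp add: ennreal_leI)
qed

text \<open>
  The left-hand side is the integral of the Gaussian over the cone with apex \<open>0\<close> over the facet \<open>F\<close>.
\<close>
lemma facet_term_le:
  fixes F :: "'a::euclidean_space set"
  assumes F: "polytope F" "aff_dim F = int (Suc m)"
    and dist: "\<And>E j x. E face_of F \<Longrightarrow> aff_dim E = int j \<Longrightarrow> x \<in> E \<Longrightarrow> real (m + 2) - real j \<le> (norm x)\<^sup>2"
  shows "ennreal (infdist 0 (affine hull F)) * (\<integral>\<^sup>+s. indicator {0<..} s * ennreal (s ^ Suc m) *
           face_integral F (\<lambda>y. ennreal (exp (- (norm (s *\<^sub>R y))\<^sup>2))) \<partial>lborel)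
    \<le> ennreal (ridge_scale m * cube_const m) * (\<Sum>G | G facet_of F. face_volume G)"
proof -
  have "F \<noteq> {}" using F by auto
  then obtain p where p: "p \<in> F" "\<And>y. y \<in> F \<Longrightarrow> (norm p)\<^sup>2 \<le> p \<bullet> y"
    using nearest_point_face F(1) by metis
  define P where "P = (norm p)\<^sup>2"
  have "F face_of F" using F by (simp add: face_of_refl polytope_imp_convex)
  then have P1: "1 \<le> P" using dist[OF _ F(2) p(1)] by (simp add: P_def)
  define h where "h = infdist 0 (affine hull F)"
  have "h \<le> norm p" using infdist_le[of p "affine hull F" 0] p(1) by (simp add: h_def hull_inc)
  then have h: "0 \<le> h" "h\<^sup>2 \<le> P" by (auto simp: h_def infdist_nonneg P_def power_mono)
  define d where "d G = infdist p (affine hull G)" for G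
  have d0: "d G \<ge> 0" for G by (simp add: d_def infdist_nonneg)
  have fin [simp]: "finite {G. G facet_of F}" using F by (simp add: finite_polytope_facets)
  note facet = polytope_facet_borel[OF F(1) _ F(2)]
  have profile: "face_integral G (\<lambda>y. ennreal (exp (- b\<^sup>2 * (norm y)\<^sup>2))) \<le> ennreal (ridge_profile m (d G) b) * face_volume G"
    if G: "G facet_of F" and "b > 0" for G b
  proof (cases "d G \<le> ridge_scale m")
    case True
    have "face_integral G (\<lambda>x. ennreal (exp (- b\<^sup>2 * (norm x)\<^sup>2)))
        \<le> ennreal (exp (- b\<^sup>2 * 2) * (gauss_int b / b) ^ m) * face_volume G"
    proof (rule face_integral_gaussian_le[OF facet(4,2)[OF G] \<open>b > 0\<close>])
      fix H j x assume H: "H face_of G" "aff_dim H = int j" "x \<in> H"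
      then show "2 + real m - real j \<le> (norm x)\<^sup>2"
        using dist[of H j x] face_of_trans[OF H(1) facet(5)[OF G]] by simp
    qed
    then show ?thesis using True by (simp add: ridge_profile_def)
  next
    case False
    \<comment> \<open>The angle at \<open>p\<close> between the origin and \<open>y\<close> is not acute, and \<open>|p| \<ge> 1\<close>.\<close>
    have "1 + (d G)\<^sup>2 \<le> (norm y)\<^sup>2" if "y \<in> G" for y
    proof -
      have "d G \<le> norm (y - p)"
        using infdist_le[of y "affine hull G" p] that by (simp add: d_def hull_inc dist_norm norm_minus_commute)
      then have "(d G)\<^sup>2 \<le> (norm (y - p))\<^sup>2" using d0 by (intro power_mono)
      moreover have "(norm y)\<^sup>2 = (norm (y - p))\<^sup>2 + 2 * (p \<bullet> y) - (norm p)\<^sup>2"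
        by (simp add: power2_norm_eq_inner inner_diff_left inner_diff_right inner_commute)
      moreover have "(norm p)\<^sup>2 \<le> p \<bullet> y" using p(2) facet(1)[OF G] that by auto
      ultimately show ?thesis using P1 by (simp add: P_def)
    qed
    then have "b\<^sup>2 * (1 + (d G)\<^sup>2) \<le> b\<^sup>2 * (norm y)\<^sup>2" if "y \<in> G" for y
      using that by (intro mult_left_mono) auto
    then have "face_integral G (\<lambda>y. ennreal (exp (- b\<^sup>2 * (norm y)\<^sup>2))) \<le> face_integral G (\<lambda>y. ennreal (exp (- b\<^sup>2 * (1 + (d G)\<^sup>2))))"
      by (intro face_integral_mono) auto
    then show ?thesis using False facet(3)[OF G] by (simp add: face_integral_const ridge_profile_def)
  qed
  let ?T = "\<lambda>G s t. indicator {0<..1} t * ennreal (t ^ m) *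
     (ennreal (exp (- (s\<^sup>2 - (s * t)\<^sup>2) * P)) * ennreal (ridge_profile m (d G) (s * t)))"
  have level: "face_integral F (\<lambda>y. ennreal (exp (- (norm (s *\<^sub>R y))\<^sup>2)))
      \<le> (\<Sum>G | G facet_of F. ennreal (d G) * face_volume G * (\<integral>\<^sup>+t. ?T G s t \<partial>lborel))" if "s > 0" for s
  proof -
    have "face_integral F (\<lambda>y. ennreal (exp (- (norm (s *\<^sub>R y))\<^sup>2))) = face_integral F (\<lambda>y. ennreal (exp (- s\<^sup>2 * (norm y)\<^sup>2)))"
      by (simp add: power_mult_distrib)
    also have "\<dots> \<le> (\<Sum>G | G facet_of F. ennreal (infdist p (affine hull G)) *
        (\<integral>\<^sup>+t. indicator {0<..1} t * ennreal (t ^ m) *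
           face_integral G (\<lambda>y. ennreal (exp (- s\<^sup>2 * (norm (p + t *\<^sub>R (y - p)))\<^sup>2))) \<partial>lborel))"
      by (rule face_integral_le_facets[OF F p(1)]) measurable
    also have "\<dots> \<le> (\<Sum>G | G facet_of F. ennreal (d G) * (\<integral>\<^sup>+t. ?T G s t * face_volume G \<partial>lborel))"
      unfolding d_def[symmetric]
    proof (intro sum_mono mult_left_mono nn_integral_mono)
      fix G t assume "G \<in> {G. G facet_of F}"
      then have G: "G facet_of F" by simp
      show "indicator {0<..1} t * ennreal (t ^ m) *
           face_integral G (\<lambda>y. ennreal (exp (- s\<^sup>2 * (norm (p + t *\<^sub>R (y - p)))\<^sup>2))) \<le> ?T G s t * face_volume G"
      proof (cases "t \<in> {0<..1}")
        case True
        have "face_integral G (\<lambda>y. ennreal (exp (- s\<^sup>2 * (norm (p + t *\<^sub>R (y - p)))\<^sup>2)))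
           \<le> ennreal (exp (- (s\<^sup>2 - (s * t)\<^sup>2) * P)) * face_integral G (\<lambda>y. ennreal (exp (- (s * t)\<^sup>2 * (norm y)\<^sup>2)))"
          using True facet[OF G] p by (intro face_integral_towards_le) (auto simp: P_def)
        also have "\<dots> \<le> ennreal (exp (- (s\<^sup>2 - (s * t)\<^sup>2) * P)) * (ennreal (ridge_profile m (d G) (s * t)) * face_volume G)"
          using True \<open>s > 0\<close> by (intro mult_left_mono profile[OF G]) auto
        finally have "ennreal (t ^ m) * face_integral G (\<lambda>y. ennreal (exp (- s\<^sup>2 * (norm (p + t *\<^sub>R (y - p)))\<^sup>2)))
          \<le> ennreal (t ^ m) * (ennreal (exp (- (s\<^sup>2 - (s * t)\<^sup>2) * P)) * (ennreal (ridge_profile m (d G) (s * t)) * face_volume G))"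
          by (intro mult_left_mono) auto
        then show ?thesis using True by (simp add: mult.assoc)
      qed auto
    qed auto
    also have "\<dots> = (\<Sum>G | G facet_of F. ennreal (d G) * face_volume G * (\<integral>\<^sup>+t. ?T G s t \<partial>lborel))"
    proof (intro sum.cong refl)
      fix G
      have rearrange: "x * (y * z) = x * z * y" for x y z :: ennreal by (simp add: ac_simps)
      have T: "?T G s \<in> borel_measurable lborel" by measurable
      show "ennreal (d G) * (\<integral>\<^sup>+t. ?T G s t * face_volume G \<partial>lborel) = ennreal (d G) * face_volume G * (\<integral>\<^sup>+t. ?T G s t \<partial>lborel)"
        unfolding nn_integral_multc[OF T] by (rule rearrange)
    qed
    finally show ?thesis .
  qed
  have [measurable]: "(\<lambda>s. \<integral>\<^sup>+t. ?T G s t \<partial>lborel) \<in> borel_measurable lborel" for G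
  proof -
    have "(\<lambda>s. \<integral>\<^sup>+t. (if 0 < t \<and> t \<le> 1 then 1 else 0) * ennreal (t ^ m) *
     (ennreal (exp (- (s\<^sup>2 - (s * t)\<^sup>2) * P)) * ennreal (ridge_profile m (d G) (s * t))) \<partial>lborel) \<in> borel_measurable lborel"
      by measurable
    moreover have "indicator {0<..1} t = (if 0 < t \<and> t \<le> 1 then 1 else (0::ennreal))" for t :: real by simp
    ultimately show ?thesis by simp
  qed
  have "ennreal h * (\<integral>\<^sup>+s. indicator {0<..} s * ennreal (s ^ Suc m) *
           face_integral F (\<lambda>y. ennreal (exp (- (norm (s *\<^sub>R y))\<^sup>2))) \<partial>lborel)
     \<le> ennreal h * (\<integral>\<^sup>+s. (\<Sum>G | G facet_of F. ennreal (d G) * face_volume G *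
         (indicator {0<..} s * ennreal (s ^ Suc m) * (\<integral>\<^sup>+t. ?T G s t \<partial>lborel))) \<partial>lborel)"
  proof (intro mult_left_mono nn_integral_mono)
    fix s :: real
    show "indicator {0<..} s * ennreal (s ^ Suc m) * face_integral F (\<lambda>y. ennreal (exp (- (norm (s *\<^sub>R y))\<^sup>2)))
      \<le> (\<Sum>G | G facet_of F. ennreal (d G) * face_volume G *
         (indicator {0<..} s * ennreal (s ^ Suc m) * (\<integral>\<^sup>+t. ?T G s t \<partial>lborel)))"
    proof (cases "s > 0")
      case True
      have "ennreal (s ^ Suc m) * face_integral F (\<lambda>y. ennreal (exp (- (norm (s *\<^sub>R y))\<^sup>2)))
        \<le> ennreal (s ^ Suc m) * (\<Sum>G | G facet_of F. ennreal (d G) * face_volume G * (\<integral>\<^sup>+t. ?T G s t \<partial>lborel))"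
        by (intro mult_left_mono level True) auto
      also have "\<dots> = (\<Sum>G | G facet_of F. ennreal (d G) * face_volume G * (ennreal (s ^ Suc m) * (\<integral>\<^sup>+t. ?T G s t \<partial>lborel)))"
        by (simp only: sum_distrib_left mult.left_commute)
      finally show ?thesis using True by (simp del: power_Suc)
    qed auto
  qed auto
  also have "\<dots> = (\<Sum>G | G facet_of F. face_volume G * (ennreal (d G) * (ennreal h *
      (\<integral>\<^sup>+s. indicator {0<..} s * ennreal (s ^ Suc m) * (\<integral>\<^sup>+t. ?T G s t \<partial>lborel) \<partial>lborel))))"
    by (subst nn_integral_sum) (auto simp: nn_integral_cmult sum_distrib_left ac_simps simp del: power_Suc intro!: sum.cong)
  also have "\<dots> \<le> (\<Sum>G | G facet_of F. face_volume G * ennreal (ridge_scale m * cube_const m))"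
  proof (intro sum_mono mult_left_mono)
    fix G
    have "ennreal (d G) * (ennreal h * (\<integral>\<^sup>+s. indicator {0<..} s * ennreal (s ^ Suc m) * (\<integral>\<^sup>+t. ?T G s t \<partial>lborel) \<partial>lborel))
      \<le> ennreal (d G) * (\<integral>\<^sup>+b. ennreal (b ^ m * ((sqrt pi / 2 - gauss_int b) * exp (b\<^sup>2))) * ennreal (ridge_profile m (d G) b) * indicator {0<..} b \<partial>lborel)"
      using P1 h by (intro mult_left_mono nn_integral_fold_cones_le) auto
    also have "\<dots> \<le> ennreal (ridge_scale m * cube_const m)"
      by (rule ridge_profile_integral_le[OF d0])
    finally show "ennreal (d G) * (ennreal h * (\<integral>\<^sup>+s. indicator {0<..} s * ennreal (s ^ Suc m) * (\<integral>\<^sup>+t. ?T G s t \<partial>lborel) \<partial>lborel))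
      \<le> ennreal (ridge_scale m * cube_const m)" .
  qed auto
  also have "\<dots> = ennreal (ridge_scale m * cube_const m) * (\<Sum>G | G facet_of F. face_volume G)"
    by (simp only: sum_distrib_left mult.commute)
  finally show ?thesis by (simp only: h_def)
qed

section \<open>Summation over the ridges\<close>

text \<open>
  On a ball around \<open>a\<close> of radius \<open>r\<close>, the function \<open>exp (r^2 - |x - a|^2)\<close> is at least \<open>1\<close>, and its
  integral is known.
\<close>
lemma face_volume_finite:
  fixes G :: "'a::euclidean_space set"
  assumes "bounded G" "G \<in> sets borel" "G \<noteq> {}"
  shows "face_volume G < \<infinity>"
proof -
  obtain a B where aB: "orthonormal_frame (affine hull G) a B"
    using orthonormal_frame_exists[of "affine hull G"] assms(3) by auto
  have B: "pairwise orthogonal B" "\<forall>b\<in>B. norm b = 1" using aB by (auto simp: orthonormal_frame_def)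
  note fin = orthonormal_finite(1)[OF B]
  obtain r where "G \<subseteq> ball a r" using bounded_subset_ballD[OF assms(1), of a] by blast
  then have r: "norm (x - a) \<le> r" if "x \<in> G" for x
    using that by (force simp: dist_norm norm_minus_commute)
  let ?e = "\<lambda>x. ennreal (exp (r\<^sup>2)) * ennreal (exp (- (norm (x - a))\<^sup>2))"
  have "face_volume G = (\<integral>\<^sup>+x. indicator G x \<partial>frame_measure a B)"
    using assms by (simp add: face_volume_def flat_measure_eq_frame_measure[OF aB])
  also have "\<dots> \<le> (\<integral>\<^sup>+x. ?e x \<partial>frame_measure a B)"
  proof (intro nn_integral_mono)
    fix x
    have "1 \<le> ?e x" if "x \<in> G"
    proof -
      have "(norm (x - a))\<^sup>2 \<le> r\<^sup>2" using r[OF that] by (intro power_mono) auto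
      then have "1 \<le> exp (r\<^sup>2) * exp (- (norm (x - a))\<^sup>2)" by (simp flip: exp_add)
      then have "ennreal 1 \<le> ennreal (exp (r\<^sup>2) * exp (- (norm (x - a))\<^sup>2))" by (rule ennreal_leI)
      then show ?thesis by (simp add: ennreal_mult')
    qed
    then show "indicator G x \<le> ?e x" by (auto simp: indicator_def)
  qed
  also have "\<dots> = (\<integral>\<^sup>+x. ennreal (exp (r\<^sup>2)) * ennreal (exp (- (norm x)\<^sup>2)) \<partial>frame_measure 0 B)"
    using nn_integral_frame_measure_affine[OF fin, of 1 ?e a 0] by simp
  also have "\<dots> = ennreal (exp (r\<^sup>2)) * ennreal (sqrt pi ^ card B)"
    by (simp add: nn_integral_cmult nn_integral_gaussian_frame[OF B])
  also have "\<dots> < \<infinity>" by (simp add: ennreal_mult_less_top)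
  finally show ?thesis .
qed

lemma facet_subset_facet_eq:
  fixes P :: "'a::euclidean_space set"
  assumes F: "F facet_of P" "F' facet_of P" "F \<subseteq> F'"
  shows "F = F'"
proof (rule ccontr)
  assume "F \<noteq> F'"
  have "F face_of F'" using F by (meson face_of_subset facet_of_imp_face_of facet_of_imp_subset)
  moreover have "convex F'" using F(2) by (auto simp: facet_of_def face_of_imp_convex)
  ultimately show False using face_of_aff_dim_lt[of F' F] \<open>F \<noteq> F'\<close> F by (auto simp: facet_of_def)
qed

text \<open>
  Each equation forces two of the coefficients to have opposite signs or to vanish together, and
  three real numbers cannot be pairwise of opposite sign.
\<close>
lemma three_signs_impossible:
  assumes neg: "a12 < 0" "a13 < 0" "a21 < 0" "a23 < 0" "a31 < 0" "a32 < (0::real)"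
    and eq: "l2 * a12 + l3 * a13 = 0" "l1 * a21 + l3 * a23 = 0" "l1 * a31 + l2 * a32 = 0"
  shows "l1 = 0 \<and> l2 = 0 \<and> l3 = 0"
proof -
  have sg: "(x > 0 \<longrightarrow> y < 0) \<and> (x < 0 \<longrightarrow> y > 0) \<and> (x = 0 \<longrightarrow> y = 0)"
    if "x * s + y * t = 0" "s < 0" "t < 0" for x y s t :: real
  proof (intro conjI impI)
    assume "x > 0"
    then have "x * s < 0" using that by (simp add: mult_pos_neg)
    then have "y * t > 0" using that by simp
    then show "y < 0" using that by (simp add: zero_less_mult_iff)
  next
    assume "x < 0"
    then have "x * s > 0" using that by (simp add: mult_neg_neg)
    then have "y * t < 0" using that by simp
    then show "y > 0" using that by (simp add: mult_less_0_iff)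
  next
    assume "x = 0"
    then show "y = 0" using that by simp
  qed
  show ?thesis
    using sg[OF eq(1) neg(1,2)] sg[OF eq(2) neg(3,4)] sg[OF eq(3) neg(5,6)] by linarith
qed

text \<open>
  The outer normals of the facets through \<open>G\<close> lie in the plane orthogonal to \<open>G\<close>, so for three facets
  they satisfy a linear relation. Take its inner product with \<open>x - g\<close>, where \<open>g\<close> is in \<open>G\<close> and \<open>x\<close> is
  a point of one facet that lies in neither of the other two. The term of that facet vanishes, and
  the normals of the other two have negative inner products with \<open>x - g\<close>. Doing this for each facet
  gives the equations of \<open>three_signs_impossible\<close>.
\<close>
lemma card_facets_through_ridge_le_2:
  fixes P :: "'a::euclidean_space set"
  assumes P: "polytope P" "aff_dim P = int (m + 2)" "DIM('a) = m + 2"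
    and G: "aff_dim G = int m"
  shows "card {F. F facet_of P \<and> G facet_of F} \<le> 2"
proof (rule ccontr)
  let ?S = "{F. F facet_of P \<and> G facet_of F}"
  assume "\<not> card ?S \<le> 2"
  then have "3 \<le> card ?S" by simp
  then obtain T where "T \<subseteq> ?S" "card T = 3" using obtain_subset_with_card_n by metis
  then obtain F1 F2 F3 where F: "F1 \<in> ?S" "F2 \<in> ?S" "F3 \<in> ?S" and ne: "F1 \<noteq> F2" "F1 \<noteq> F3" "F2 \<noteq> F3"
    by (auto simp: card_3_iff)
  obtain g where g: "g \<in> G" using G by fastforce
  define U where "U = span ((\<lambda>x. x - g) ` G)"
  have "dim U = m"
    using aff_dim_eq_dim_subtract[of g G] g G by (simp add: U_def hull_inc dim_span)
  define W where "W = {y \<in> UNIV. \<forall>x\<in>U. orthogonal x y}"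
  have "dim W = 2"
    using dim_subspace_orthogonal_to_vectors[of U UNIV] \<open>dim U = m\<close> P(3) by (simp add: W_def U_def)
  have normal: "\<exists>a b. P \<subseteq> {x. a \<bullet> x \<le> b} \<and> F = P \<inter> {x. a \<bullet> x = b} \<and> a \<in> W \<and> a \<bullet> g = b"
    if "F \<in> ?S" for F
  proof -
    have "F exposed_face_of P"
      using that polytope_imp_polyhedron[OF P(1)] by (simp add: exposed_face_of_polyhedron facet_of_def)
    then obtain a b where ab: "P \<subseteq> {x. a \<bullet> x \<le> b}" "F = P \<inter> {x. a \<bullet> x = b}"
      by (auto simp: exposed_face_of_def)
    have GF: "G \<subseteq> F" using that facet_of_imp_subset by auto
    have ag: "a \<bullet> g = b" using GF g ab(2) by auto
    have "orthogonal x a" if "x \<in> (\<lambda>x. x - g) ` G" for x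
    proof -
      obtain y where "x = y - g" "a \<bullet> y = b" using \<open>x \<in> (\<lambda>x. x - g) ` G\<close> GF ab(2) by auto
      then show ?thesis using ag by (simp add: orthogonal_def inner_diff_right inner_commute[of _ a])
    qed
    then have "\<forall>x\<in>U. orthogonal a x"
      using orthogonal_to_span[of _ "(\<lambda>x. x - g) ` G" a] unfolding U_def by (metis orthogonal_commute)
    then have "a \<in> W" by (auto simp: W_def orthogonal_commute)
    then show ?thesis using ab ag by blast
  qed
  obtain a1 b1 where 1: "P \<subseteq> {x. a1 \<bullet> x \<le> b1}" "F1 = P \<inter> {x. a1 \<bullet> x = b1}" "a1 \<in> W" "a1 \<bullet> g = b1"
    using normal[OF F(1)] by blast
  obtain a2 b2 where 2: "P \<subseteq> {x. a2 \<bullet> x \<le> b2}" "F2 = P \<inter> {x. a2 \<bullet> x = b2}" "a2 \<in> W" "a2 \<bullet> g = b2"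
    using normal[OF F(2)] by blast
  obtain a3 b3 where 3: "P \<subseteq> {x. a3 \<bullet> x \<le> b3}" "F3 = P \<inter> {x. a3 \<bullet> x = b3}" "a3 \<in> W" "a3 \<bullet> g = b3"
    using normal[OF F(3)] by blast
  \<comment> \<open>The midpoint of a point of the first facet outside the second and one outside the third lies
    outside both.\<close>
  have point: "\<exists>x\<in>F. a \<bullet> (x - g) < 0 \<and> a' \<bullet> (x - g) < 0"
    if F: "F \<in> ?S" "F' \<in> ?S" "F'' \<in> ?S" "F \<noteq> F'" "F \<noteq> F''"
      and a: "P \<subseteq> {x. a \<bullet> x \<le> b}" "F' = P \<inter> {x. a \<bullet> x = b}" "a \<bullet> g = b"
      and a': "P \<subseteq> {x. a' \<bullet> x \<le> b'}" "F'' = P \<inter> {x. a' \<bullet> x = b'}" "a' \<bullet> g = b'" for F F' F'' a b a' b'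
  proof -
    have FP: "F \<subseteq> P" "convex F" using F(1) by (auto simp: facet_of_def face_of_imp_subset face_of_imp_convex)
    obtain x where x: "x \<in> F" "x \<notin> F'" using facet_subset_facet_eq[of F P F'] F by blast
    obtain y where y: "y \<in> F" "y \<notin> F''" using facet_subset_facet_eq[of F P F''] F by blast
    have ax: "a \<bullet> x < b" "a \<bullet> y \<le> b" using x y FP a by force+
    have ay: "a' \<bullet> y < b'" "a' \<bullet> x \<le> b'" using x y FP a' by force+
    have "midpoint x y \<in> F"
      using convexD[OF FP(2) x(1) y(1), of "1/2" "1/2"] by (simp add: midpoint_def scaleR_add_right)
    moreover have mid: "c \<bullet> (midpoint x y - g) = (c \<bullet> x + c \<bullet> y) / 2 - c \<bullet> g" for c
      by (simp add: midpoint_def inner_diff_right inner_add_right field_simps)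
    moreover have "a \<bullet> (midpoint x y - g) < 0" using mid[of a] a(3) ax by simp
    moreover have "a' \<bullet> (midpoint x y - g) < 0" using mid[of a'] a'(3) ay by simp
    ultimately show ?thesis by blast
  qed
  obtain x1 where x1: "x1 \<in> F1" "a2 \<bullet> (x1 - g) < 0" "a3 \<bullet> (x1 - g) < 0"
    using point[OF F(1,2,3) ne(1,2) 2(1,2,4) 3(1,2,4)] by blast
  obtain x2 where x2: "x2 \<in> F2" "a1 \<bullet> (x2 - g) < 0" "a3 \<bullet> (x2 - g) < 0"
    using point[OF F(2,1,3) ne(1)[symmetric] ne(3) 1(1,2,4) 3(1,2,4)] by blast
  obtain x3 where x3: "x3 \<in> F3" "a1 \<bullet> (x3 - g) < 0" "a2 \<bullet> (x3 - g) < 0"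
    using point[OF F(3,1,2) ne(2,3)[symmetric] 1(1,2,4) 2(1,2,4)] by blast
  have zero: "a1 \<bullet> (x1 - g) = 0" "a2 \<bullet> (x2 - g) = 0" "a3 \<bullet> (x3 - g) = 0"
    using x1(1) x2(1) x3(1) 1 2 3 by (auto simp: inner_diff_right)
  have distinct: "a1 \<noteq> a2" "a1 \<noteq> a3" "a2 \<noteq> a3" using zero x1 x2 x3 by auto
  have "dependent {a1, a2, a3}"
  proof (rule ccontr)
    assume "independent {a1, a2, a3}"
    then have "card {a1, a2, a3} \<le> dim W" using 1 2 3 by (intro independent_card_le_dim) auto
    then show False using \<open>dim W = 2\<close> distinct by simp
  qed
  then obtain u where u: "\<exists>v\<in>{a1, a2, a3}. u v \<noteq> 0" "(\<Sum>v\<in>{a1, a2, a3}. u v *\<^sub>R v) = 0"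
    using dependent_finite[of "{a1, a2, a3}"] by auto
  have sum0: "u a1 * (a1 \<bullet> w) + u a2 * (a2 \<bullet> w) + u a3 * (a3 \<bullet> w) = 0" for w
  proof -
    have "(u a1 *\<^sub>R a1 + (u a2 *\<^sub>R a2 + u a3 *\<^sub>R a3)) \<bullet> w = 0" using u(2) distinct by simp
    then show ?thesis by (simp add: inner_add_left)
  qed
  have "u a1 = 0 \<and> u a2 = 0 \<and> u a3 = 0"
  proof (rule three_signs_impossible)
    show "u a2 * (a2 \<bullet> (x1 - g)) + u a3 * (a3 \<bullet> (x1 - g)) = 0" using sum0[of "x1 - g"] zero by simp
    show "u a1 * (a1 \<bullet> (x2 - g)) + u a3 * (a3 \<bullet> (x2 - g)) = 0" using sum0[of "x2 - g"] zero by simp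
    show "u a1 * (a1 \<bullet> (x3 - g)) + u a2 * (a2 \<bullet> (x3 - g)) = 0" using sum0[of "x3 - g"] zero by simp
  qed (use x1 x2 x3 in auto)
  then show False using u(1) by auto
qed

text \<open>
  The estimates for the single facets are summed. Exchanging the order of summation over the flags
  \<open>(F, G)\<close> counts every ridge at most twice.
\<close>
lemma ridge_bound_le_total_face_measure:
  fixes P :: "'a::euclidean_space set"
  assumes P: "polytope P" "aff_dim P = int (m + 2)" "DIM('a) = m + 2" "0 \<in> interior P"
    and dist: "\<And>E j x. E face_of P \<Longrightarrow> E \<noteq> P \<Longrightarrow> aff_dim E = int j \<Longrightarrow> x \<in> E \<Longrightarrow> real (m + 2) - real j \<le> (norm x)\<^sup>2"
  shows "ridge_bound (m + 2) \<le> total_face_measure m P"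
proof -
  let ?\<F> = "{F. F facet_of P}" and ?\<R> = "{G. G face_of P \<and> aff_dim G = int m}"
  have fin [simp]: "finite ?\<F>" "finite ?\<R>"
    using P(1) finite_polytope_faces[OF P(1)] by (auto simp: finite_polytope_facets intro: finite_subset[rotated])
  have aff: "aff_dim P = int (Suc (Suc m))" using P by simp
  note facet = polytope_facet_borel[OF P(1) _ aff]
  have R: "polytope G" "G \<noteq> {}" if "G \<in> ?\<R>" for G
    using that face_of_polytope_polytope[OF P(1)] by auto
  have volume: "face_volume G = ennreal (measure (flat_measure (affine hull G)) G)" if "G \<in> ?\<R>" for G
    using face_volume_finite[of G] R[OF that] unfolding face_volume_def
    by (intro emeasure_eq_ennreal_measure)
      (auto simp: polytope_imp_bounded borel_closed polytope_imp_closed)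
  let ?C = "ridge_scale m * cube_const m"
  have C0: "?C \<ge> 0" using ridge_scale_pos[of m] by (simp add: cube_const_def)
  have gaussian: "(\<integral>\<^sup>+x. ennreal (exp (- (norm x)\<^sup>2)) \<partial>(lborel :: 'a measure)) = ennreal (sqrt pi ^ (m + 2))"
  proof -
    have "orthonormal_frame (UNIV :: 'a set) 0 Basis"
      by (auto simp: orthonormal_frame_def pairwise_def orthogonal_def inner_Basis)
    then have "(lborel :: 'a measure) = frame_measure 0 Basis"
      using flat_measure_eq_frame_measure flat_measure_UNIV by metis
    moreover have "pairwise orthogonal (Basis :: 'a set)"
      by (auto simp: pairwise_def orthogonal_def inner_Basis)
    ultimately show ?thesis using nn_integral_gaussian_frame[of "Basis :: 'a set"] P(3) by simp
  qed
  have "ennreal (sqrt pi ^ (m + 2)) \<le> (\<Sum>F\<in>?\<F>. ennreal (infdist 0 (affine hull F)) *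
        (\<integral>\<^sup>+s. indicator {0<..} s * ennreal (s ^ Suc m) *
           face_integral F (\<lambda>y. ennreal (exp (- (norm (s *\<^sub>R y))\<^sup>2))) \<partial>lborel))"
    using nn_integral_lborel_le_facets[OF P(1,4), of "Suc m" "\<lambda>x. ennreal (exp (- (norm x)\<^sup>2))"] P(3)
    by (simp add: gaussian del: power_Suc)
  also have "\<dots> \<le> (\<Sum>F\<in>?\<F>. ennreal ?C * (\<Sum>G | G facet_of F. face_volume G))"
  proof (intro sum_mono facet_term_le)
    fix F assume "F \<in> ?\<F>"
    then have F: "F facet_of P" by simp
    show "polytope F" "aff_dim F = int (Suc m)" using facet[OF F] by auto
    fix E j x assume E: "E face_of F" "aff_dim E = int j" "x \<in> E"
    have "E face_of P" using face_of_trans[OF E(1) facet(5)[OF F]] .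
    moreover have "E \<noteq> P"
      using face_of_imp_subset[OF E(1)] facet(1)[OF F] F by (metis facet_of_irrefl subset_antisym)
    ultimately show "real (m + 2) - real j \<le> (norm x)\<^sup>2" using dist E by blast
  qed
  also have "\<dots> = ennreal ?C * (\<Sum>F\<in>?\<F>. \<Sum>G\<in>{G. G \<in> ?\<R> \<and> G facet_of F}. face_volume G)"
  proof -
    have "G \<in> ?\<R>" if "F facet_of P" "G facet_of F" for F G
      using polytope_facet_borel(2,5)[OF facet(4)[OF that(1)] that(2) facet(2)[OF that(1)]]
        facet(5)[OF that(1)] by (auto intro: face_of_trans)
    then have "{G. G facet_of F} = {G. G \<in> ?\<R> \<and> G facet_of F}" if "F \<in> ?\<F>" for F
      using that by blast
    then show ?thesis by (simp add: sum_distrib_left)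
  qed
  also have "(\<Sum>F\<in>?\<F>. \<Sum>G\<in>{G. G \<in> ?\<R> \<and> G facet_of F}. face_volume G)
      = (\<Sum>G\<in>?\<R>. \<Sum>F\<in>{F. F \<in> ?\<F> \<and> G facet_of F}. face_volume G)"
    by (rule sum.swap_restrict[OF fin])
  also have "\<dots> \<le> (\<Sum>G\<in>?\<R>. 2 * face_volume G)"
  proof (intro sum_mono)
    fix G assume "G \<in> ?\<R>"
    then have "card {F. F \<in> ?\<F> \<and> G facet_of F} \<le> 2"
      using card_facets_through_ridge_le_2[OF P(1-3), of G] by simp
    then have "(of_nat (card {F. F \<in> ?\<F> \<and> G facet_of F}) :: ennreal) \<le> of_nat 2"
      by (simp only: of_nat_le_iff)
    then show "(\<Sum>F\<in>{F. F \<in> ?\<F> \<and> G facet_of F}. face_volume G) \<le> 2 * face_volume G"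
      by (simp add: mult_right_mono)
  qed
  also have "\<dots> = ennreal (2 * total_face_measure m P)"
  proof -
    have "(\<Sum>G\<in>?\<R>. 2 * face_volume G) = 2 * (\<Sum>G\<in>?\<R>. ennreal (measure (flat_measure (affine hull G)) G))"
      by (subst sum_distrib_left) (intro sum.cong refl, simp only: volume)
    also have "\<dots> = 2 * ennreal (total_face_measure m P)"
      unfolding total_face_measure_def by (subst sum_ennreal) auto
    finally show ?thesis by (simp add: ennreal_mult')
  qed
  finally have "ennreal (sqrt pi ^ (m + 2)) \<le> ennreal ?C * ennreal (2 * total_face_measure m P)"
    by (simp add: mult_left_mono)
  moreover have T0: "total_face_measure m P \<ge> 0" by (simp add: total_face_measure_def sum_nonneg)
  ultimately have "sqrt pi ^ (m + 2) \<le> ?C * (2 * total_face_measure m P)"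
    using C0 by (simp add: ennreal_mult'[symmetric] ennreal_le_iff del: power_Suc)
  also have "\<dots> = (sqrt pi / 2) ^ (m + 2) * (2 * ridge_scale m * total_face_measure m P / (real (m + 1) * real (m + 2)))"
    by (simp add: cube_const_def)
  finally have "(sqrt pi / 2) ^ (m + 2) * 2 ^ (m + 2)
      \<le> (sqrt pi / 2) ^ (m + 2) * (2 * ridge_scale m * total_face_measure m P / (real (m + 1) * real (m + 2)))"
    by (simp add: power_divide)
  then have "2 ^ (m + 2) \<le> 2 * ridge_scale m * total_face_measure m P / (real (m + 1) * real (m + 2))"
    by (rule mult_left_le_imp_le) simp
  then have "real (m + 1) * real (m + 2) * 2 ^ (m + 1) \<le> ridge_scale m * total_face_measure m P"
    by (simp add: pos_le_divide_eq ac_simps)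
  then have "ridge_scale m * ridge_bound (m + 2) \<le> ridge_scale m * total_face_measure m P"
    by (simp only: ridge_scale_bound)
  then show ?thesis using ridge_scale_pos by (rule mult_left_le_imp_le)
qed

section \<open>Asymptotics and numerical value of the bound\<close>

text \<open>
  The difference is \<open>ln z\<close> for some \<open>z\<close> between \<open>x\<close> and \<open>x + 1\<close>, by the mean value theorem.
\<close>
lemma x_ln_x_step:
  fixes x :: real
  assumes "x > 0"
  shows "((x + 1) * ln (x + 1) - (x + 1)) - (x * ln x - x) \<le> ln (x + 1)"
    and "ln x \<le> ((x + 1) * ln (x + 1) - (x + 1)) - (x * ln x - x)"
proof -
  have "\<exists>z. x < z \<and> z < x + 1 \<and> ((x + 1) * ln (x + 1) - (x + 1)) - (x * ln x - x) = (x + 1 - x) * ln z"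
    using assms by (intro MVT2) (auto intro!: derivative_eq_intros)
  then obtain z where z: "x < z" "z < x + 1" "((x + 1) * ln (x + 1) - (x + 1)) - (x * ln x - x) = ln z"
    by auto
  then show "((x + 1) * ln (x + 1) - (x + 1)) - (x * ln x - x) \<le> ln (x + 1)"
    and "ln x \<le> ((x + 1) * ln (x + 1) - (x + 1)) - (x * ln x - x)"
    using assms by auto
qed

text \<open>
  When \<open>x\<close> grows by \<open>1\<close>, \<open>ln (\<Gamma>(x + 1))\<close> grows by \<open>ln (x + 1)\<close>, which lies between the increments of
  \<open>F x\<close> and of \<open>F (x + 1)\<close>. The induction has steps of two in \<open>N = 2 x\<close>, so the constant has to cover
  \<open>N = 1\<close> and \<open>N = 2\<close>.
\<close>
lemma ln_Gamma_half_bounds: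
  defines "F \<equiv> \<lambda>x::real. x * ln x - x"
  shows "\<exists>C. \<forall>N\<ge>1. F (real N / 2) - C \<le> ln (Gamma (real N / 2 + 1))
     \<and> ln (Gamma (real N / 2 + 1)) \<le> F (real N / 2 + 1) + C"
proof -
  let ?A = "\<lambda>N::nat. ln (Gamma (real N / 2 + 1))"
  define C where "C = (\<Sum>N\<in>{1,2}. \<bar>F (real N / 2) - ?A N\<bar> + \<bar>?A N - F (real N / 2 + 1)\<bar>)"
  have "F (real (Suc N) / 2) - C \<le> ?A (Suc N) \<and> ?A (Suc N) \<le> F (real (Suc N) / 2 + 1) + C" for N
  proof (induction N rule: induct_nat_012)
    case 0 then show ?case by (simp add: C_def) linarith
  next
    case 1 then show ?case by (simp add: C_def) linarith
  next
    case (ge2 N)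
    define x where "x = real (Suc N) / 2"
    have x: "x > 0" by (simp add: x_def)
    have idx: "real (Suc (Suc (Suc N))) / 2 = x + 1" by (simp add: x_def field_simps)
    have "Gamma (x + 1 + 1) = (x + 1) * Gamma (x + 1)"
      using x by (intro Gamma_plus1) (auto elim!: nonpos_Ints_cases)
    then have "ln (Gamma (x + 1 + 1)) = ln (x + 1) + ln (Gamma (x + 1))"
      using x by (simp add: ln_mult_pos)
    moreover have "F (x + 1) - F x \<le> ln (x + 1)" "ln (x + 1) \<le> F (x + 1 + 1) - F (x + 1)"
      using x_ln_x_step(1)[of x] x_ln_x_step(2)[of "x + 1"] x by (auto simp: F_def)
    ultimately show ?case using ge2(1) unfolding idx x_def[symmetric] by linarith
  qed
  then show ?thesis by (metis One_nat_def Suc_le_D)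
qed

lemma ln_Gamma_half_limit:
  "(\<lambda>m. ln (Gamma (real (m + 1) / 2 + 1)) / real (m + 1) - ln (real (m + 1) / 2) / 2) \<longlonglongrightarrow> - (1 / 2)"
proof -
  obtain C where C: "\<And>N::nat. N \<ge> 1 \<Longrightarrow> (real N / 2) * ln (real N / 2) - real N / 2 - C \<le> ln (Gamma (real N / 2 + 1))"
     "\<And>N::nat. N \<ge> 1 \<Longrightarrow> ln (Gamma (real N / 2 + 1)) \<le> (real N / 2 + 1) * ln (real N / 2 + 1) - (real N / 2 + 1) + C"
    using ln_Gamma_half_bounds by blast
  let ?lo = "\<lambda>m::nat. ((real (m + 1) / 2) * ln (real (m + 1) / 2) - real (m + 1) / 2 - C) / real (m + 1) - ln (real (m + 1) / 2) / 2"
  let ?hi = "\<lambda>m::nat. ((real (m + 1) / 2 + 1) * ln (real (m + 1) / 2 + 1) - (real (m + 1) / 2 + 1) + C) / real (m + 1) - ln (real (m + 1) / 2) / 2"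
  show ?thesis
  proof (rule tendsto_sandwich)
    show "eventually (\<lambda>m. ?lo m \<le> ln (Gamma (real (m + 1) / 2 + 1)) / real (m + 1) - ln (real (m + 1) / 2) / 2) sequentially"
      by (intro always_eventually allI diff_right_mono divide_right_mono C(1)) simp_all
    show "eventually (\<lambda>m. ln (Gamma (real (m + 1) / 2 + 1)) / real (m + 1) - ln (real (m + 1) / 2) / 2 \<le> ?hi m) sequentially"
      by (intro always_eventually allI diff_right_mono divide_right_mono C(2)) simp_all
    show "?lo \<longlonglongrightarrow> - (1 / 2)" by real_asymp
    show "?hi \<longlonglongrightarrow> - (1 / 2)" by real_asymp
  qed
qed

text \<open>
  The quotient is \<open>2 N / (\<rho> sqrt (2 pi e) sqrt n)\<close> with \<open>N = n - 1\<close>. In its logarithm the constants cancel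
  once \<open>ln (\<Gamma>(N/2 + 1)) / N\<close> is replaced by \<open>ln (N/2) / 2 - 1/2\<close>.
\<close>
lemma ridge_bound_asymp_equiv:
  "asymp_equiv ridge_bound at_top (\<lambda>n. sqrt (2 * pi * exp 1) / 4 * 2 ^ n * real n powr (3 / 2))"
proof (rule asymp_equivI')
  let ?g = "\<lambda>n. sqrt (2 * pi * exp 1) / 4 * 2 ^ n * real n powr (3 / 2)"
  let ?\<delta> = "\<lambda>m. ln (Gamma (real (m + 1) / 2 + 1)) / real (m + 1) - ln (real (m + 1) / 2) / 2"
  let ?\<epsilon> = "\<lambda>m. ln (real (m + 1)) / 2 - ln (real (m + 2)) / 2 - ln (real (m + 2)) / real (m + 1)"
  have "?\<epsilon> \<longlonglongrightarrow> 0" by real_asymp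
  then have "(\<lambda>m. exp (?\<epsilon> m - (?\<delta> m + 1 / 2))) \<longlonglongrightarrow> exp (0 - (- (1 / 2) + 1 / 2))"
    by (intro tendsto_intros ln_Gamma_half_limit)
  moreover have "exp (?\<epsilon> m - (?\<delta> m + 1 / 2)) = ridge_bound (m + 2) / ?g (m + 2)" for m
  proof -
    define N where "N = real (m + 1)"
    define n where "n = real (m + 2)"
    have N: "N > 0" "n > 0" by (auto simp: N_def n_def)
    define G where "G = Gamma (N / 2 + 1)"
    have G: "G > 0" using N by (simp add: G_def)
    have "(real m + 3) / 2 = N / 2 + 1" by (simp add: N_def field_simps)
    moreover have "(sqrt pi / 2) ^ (m + 1) = (sqrt pi / 2) powr N"
      unfolding N_def by (rule powr_realpow[symmetric]) simp
    ultimately have scale: "ridge_scale m = (n * G / (sqrt pi / 2) powr N) powr (1 / N)"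
      by (simp only: ridge_scale_def n_def[symmetric] N_def[symmetric] G_def)
    have ln_scale: "ln (ridge_scale m) = (ln n + ln G) / N - (ln pi / 2 - ln 2)"
    proof -
      have "ln (ridge_scale m) = (1 / N) * (ln n + ln G - N * ln (sqrt pi / 2))"
        unfolding scale using N G by (simp add: ln_powr ln_div ln_mult)
      also have "ln (sqrt pi / 2) = ln pi / 2 - ln 2" by (simp add: ln_div ln_sqrt)
      finally show ?thesis using N by (simp add: field_simps)
    qed
    have "ridge_bound (m + 2) = N * n * 2 ^ (m + 1) / ridge_scale m"
      using ridge_scale_bound[of m] ridge_scale_pos[of m] by (simp add: N_def n_def field_simps)
    moreover have "?g (m + 2) = sqrt (2 * pi * exp 1) / 2 * 2 ^ (m + 1) * (n * sqrt n)"
    proof -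
      have "n powr (3 / 2) = n powr (1 + 1 / 2)" by simp
      also have "\<dots> = n * sqrt n" using N by (simp only: powr_add powr_half_sqrt powr_one)
      finally show ?thesis by (simp add: n_def)
    qed
    ultimately have "ridge_bound (m + 2) / ?g (m + 2) = 2 * N / (ridge_scale m * sqrt (2 * pi * exp 1) * sqrt n)"
      using N by (simp add: field_simps)
    also have "\<dots> = exp (ln (2 * N / (ridge_scale m * sqrt (2 * pi * exp 1) * sqrt n)))"
      using N ridge_scale_pos[of m] by (intro exp_ln[symmetric]) simp
    also have "ln (2 * N / (ridge_scale m * sqrt (2 * pi * exp 1) * sqrt n))
       = ln 2 + ln N - (ln (ridge_scale m) + (ln 2 + ln pi + 1) / 2 + ln n / 2)"
      using N ridge_scale_pos[of m] by (simp add: ln_div ln_mult ln_sqrt)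
    also have "\<dots> = (ln N / 2 - ln n / 2 - ln n / N) - ((ln G / N - ln (N / 2) / 2) + 1 / 2)"
      unfolding ln_scale using N by (simp add: ln_div add_divide_distrib diff_divide_distrib)
    finally show ?thesis by (simp only: N_def n_def G_def)
  qed
  ultimately have "(\<lambda>m. ridge_bound (m + 2) / ?g (m + 2)) \<longlonglongrightarrow> 1" by simp
  then show "(\<lambda>n. ridge_bound n / ?g n) \<longlonglongrightarrow> 1" by (rule LIMSEQ_offset)
qed

lemma ridge_constant_numeric: "\<bar>sqrt (2 * pi * exp 1) / 4 - 1.0332\<bar> < (0.00005 :: real)"
proof -
  have e: "2.71828 \<le> exp (1::real)" "exp (1::real) \<le> 2.71829"
    using e_approx_32 by (auto simp: abs_if split: if_split_asm)
  have "3.14159 * 2.71828 \<le> pi * exp 1" "pi * exp 1 \<le> 3.1416 * 2.71829"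
    by (rule mult_mono; use pi_approx e in auto)+
  then have "4.1327\<^sup>2 \<le> 2 * pi * exp 1" "2 * pi * exp 1 \<le> 4.1329\<^sup>2"
    by (simp_all add: power2_eq_square mult.assoc)
  then have "4.1327 \<le> sqrt (2 * pi * exp 1)" "sqrt (2 * pi * exp 1) \<le> 4.1329"
    using real_le_rsqrt[of "4.1327" "2 * pi * exp 1"] real_le_lsqrt[of "4.1329" "2 * pi * exp 1"] by simp_all
  then show ?thesis unfolding abs_less_iff by simp
qed

theorem proposition5p4:
  "(\<forall>P :: (real ^ 'n) set.
      CARD('n) \<ge> 3 \<longrightarrow>
      polytope P \<longrightarrow>
      aff_dim P = int CARD('n) \<longrightarrow>
      0 \<in> interior P \<longrightarrow>
      (\<forall>k \<in> {1..CARD('n)}. \<forall>F. F face_of P \<and> F \<noteq> {} \<and> F \<noteq> P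
          \<and> aff_dim F = int CARD('n) - int k
        \<longrightarrow> infdist 0 (affine hull F) \<ge> sqrt (real k)) \<longrightarrow>
      total_face_measure (CARD('n) - 2) P \<ge> ridge_bound CARD('n))
   \<and> asymp_equiv ridge_bound at_top
       (\<lambda>n. sqrt (2 * pi * exp 1) / 4 * 2 ^ n * real n powr (3 / 2))
   \<and> \<bar>sqrt (2 * pi * exp 1) / 4 - 1.0332\<bar> < 0.00005"
proof (intro conjI allI impI)
  fix P :: "(real ^ 'n) set"
  assume n: "CARD('n) \<ge> 3" and P: "polytope P" "aff_dim P = int CARD('n)" "0 \<in> interior P"
    and dist: "\<forall>k \<in> {1..CARD('n)}. \<forall>F. F face_of P \<and> F \<noteq> {} \<and> F \<noteq> P
          \<and> aff_dim F = int CARD('n) - int k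
        \<longrightarrow> infdist 0 (affine hull F) \<ge> sqrt (real k)"
  define m where "m = CARD('n) - 2"
  have m: "CARD('n) = m + 2" using n by (simp add: m_def)
  have "ridge_bound (m + 2) \<le> total_face_measure m P"
  proof (rule ridge_bound_le_total_face_measure[OF P(1)])
    show "aff_dim P = int (m + 2)" "DIM(real ^ 'n) = m + 2" "0 \<in> interior P"
      using P m by auto
    fix E j x assume E: "E face_of P" "E \<noteq> P" "aff_dim E = int j" "x \<in> E"
    define k where "k = CARD('n) - j"
    have "aff_dim E < aff_dim P"
      using E P(1) by (intro face_of_aff_dim_lt) (auto simp: polytope_imp_convex)
    then have "j < CARD('n)" using E(3) P(2) by simp
    then have k: "k \<in> {1..CARD('n)}" "aff_dim E = int CARD('n) - int k" "real k = real (m + 2) - real j"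
      using E(3) m by (auto simp: k_def)
    have "E face_of P \<and> E \<noteq> {} \<and> E \<noteq> P \<and> aff_dim E = int CARD('n) - int k"
      using E(1,2,4) k(2) by blast
    then have "sqrt (real k) \<le> infdist 0 (affine hull E)" using dist k(1) by blast
    also have "\<dots> \<le> norm x"
      using infdist_le[of x "affine hull E" 0] E(4) by (simp add: hull_inc)
    finally have "real k \<le> (norm x)\<^sup>2" by (rule sqrt_le_D)
    then show "real (m + 2) - real j \<le> (norm x)\<^sup>2" using k(3) by simp
  qed
  then show "ridge_bound CARD('n) \<le> total_face_measure (CARD('n) - 2) P" by (simp add: m)
next
  show "asymp_equiv ridge_bound at_top (\<lambda>n. sqrt (2 * pi * exp 1) / 4 * 2 ^ n * real n powr (3 / 2))"
    by (rule ridge_bound_asymp_equiv)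
next
  show "\<bar>sqrt (2 * pi * exp 1) / 4 - 1.0332\<bar> < 0.00005"
    by (rule ridge_constant_numeric)
qed

end
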